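(* Fix $\varepsilon\in(0,1)$ and run the proposed algorithm described in the context with $V=1/\varepsilon$. Suppose the optimization problem described in the context is feasible and that there exist non-negative finite constants $\gamma_1,\dots,\gamma_L$ such that $$\sum_{n=1}^N\overline f^n+\sum_{l=1}^L\gamma_l\sum_{n=1}^N\overline g^n_l\ \ge\ f_*+\sum_{l=1}^L\gamma_ld_l\qquad\text{for all }(\overline f^n,\overline{\mathbf g}^n)\in\mathcal P^n,\ n\in\{1,\dots,N\}.$$ Then for all integers $T\ge1/\varepsilon^2$, $$\frac1T\sum_{t=0}^{T-1}\sum_{n=1}^N\mathbb E\left(y^n[t]\right)\le f_*+\mathcal O(\varepsilon),\qquad \frac1T\sum_{t=0}^{T-1}\sum_{n=1}^N\mathbb E\left(z^n_l[t]\right)\le d_l+\mathcal O(\varepsilon),\quad l\in\{1,\dots,L\},$$ where $\mathcal O(\varepsilon)$ denotes a quantity bounded by $C\varepsilon$ with a constant $C$ not depending on $\varepsilon$ or $T$. Thus the algorithm provides an $\mathcal O(\varepsilon)$ approximation with convergence time $\mathcal O(1/\varepsilon^2)$.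
   Context: Renewal systems. There are $N$ systems on slotted time $t\in\{0,1,2,\dots\}$. System $n$ has renewal times $0=t^n_0<t^n_1<t^n_2<\cdots$ (integer slots); $T^n_k:=t^n_{k+1}-t^n_k\ge 1$ is the length of frame $k$ and $\mathcal T^n_k:=\{t^n_k,\dots,t^n_{k+1}-1\}$. At slot $t^n_k$ system $n$ chooses a (possibly random, possibly past-dependent) action $\alpha^n_k$ in a set $\mathcal A^n$. The action determines the distribution of $T^n_k$ and, for $t\in\mathcal T^n_k$, of a penalty $y^n[t]\in\mathbb R$ and a metric vector $\mathbf z^n[t]=(z^n_1[t],\dots,z^n_L[t])\in\mathbb R^L$. Renewal property: given $\alpha^n_k=\alpha^n$, the variables $T^n_k$, $y^n[t]$, $\mathbf z^n[t]$ ($t\in\mathcal T^n_k$) are independent of all outcomes (of all systems and of the external process below) from slots before $t^n_k$, and the conditional expectations $\widehat T^n(\alpha^n):=\mathbb E(T^n_k\mid\alpha^n_k=\alpha^n)$, $\widehat y^n(\alpha^n):=\mathbb E(\sum_{t\in\mathcal T^n_k}y^n[t]\mid\alpha^n_k=\alpha^n)$, $\widehat z^n_l(\alpha^n):=\mathbb E(\sum_{t\in\mathcal T^n_k}z^n_l[t]\mid\alpha^n_k=\alpha^n)$ do not depend on $k$. Put $\widehat f^n:=\widehat y^n/\widehat T^n$ and $\widehat{\mathbf g}^n:=\widehat{\mathbf z}^n/\widehat T^n$. Performance region. $\mathcal S^n$ is the convex hull of $\{(\widehat y^n(\alpha^n),\widehat{\mathbf z}^n(\alpha^n),\widehat T^n(\alpha^n)):\alpha^n\in\mathcal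 A^n\}\subset\mathbb R^{L+2}$ and $\mathcal P^n:=\{(y/T,\mathbf z/T):(y,\mathbf z,T)\in\mathcal S^n\}\subset\mathbb R^{L+1}$. External process. $\{\mathbf d[t]\}_{t\ge0}\subset\mathbb R^L$ is an uncontrollable external i.i.d. process with $d_l:=\mathbb E(d_l[t])$; $\mathbf d[t]$ is independent of all outcomes from slots before $t$ (in particular of $\mathbf Q[t]$ below). Optimization problem. Minimize $\limsup_{T\to\infty}\frac1T\sum_{t=0}^{T-1}\sum_{n=1}^N\mathbb E(y^n[t])$ subject to $\limsup_{T\to\infty}\frac1T\sum_{t=0}^{T-1}\sum_{n=1}^N\mathbb E(z^n_l[t])\le d_l$ for $l=1,\dots,L$, over all decision sequences. It is feasible if some decision sequences satisfy the constraints; $f_*$ denotes the infimum of the objective over all decision sequences satisfying the constraints. Standing assumptions. Boundedness: there are constants with $|y^n[t]|\le y_{\max}$, $|z^n_l[t]|\le z_{\max}$, $|d_l[t]|\le d_{\max}$ for all $n,l,t$; and there is a constant $B\ge1$ such that for all $n,k$, all $\alpha^n\in\mathcal A^n$ and all $s\in\mathbb N=\{0,1,\dots\}$ with $\Pr(T^n_k\ge s\mid\alpha^n_k=\alpha^n)>0$, $\mathbb E\left((T^n_k-s)^2\mid\alpha^n_k=\alpha^n,\,T^n_k\ge s\right)\le B$. Compactness: for each $n$ the set $\{(\widehat f^n(\alpha^n),\widehat{\mathbf g}^n(\alpha^n)):\alpha^n\in\mathcal A^n\}\subset\mathbb R^{L+1}$ is compact. Proposed algorithm (parameter $V>0$).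 Virtual queues $\mathbf Q[t]=(Q_1[t],\dots,Q_L[t])$ start at $\mathbf Q[0]=0$ and are updated every slot by $Q_l[t+1]=\max\{Q_l[t]+\sum_{n=1}^Nz^n_l[t]-d_l[t],\,0\}$. At the beginning of each frame $k$ of system $n$, the system observes $\mathbf Q[t^n_k]$ and chooses $\alpha^n_k\in\mathcal A^n$ (determined by $\mathbf Q[t^n_k]$) attaining $\min_{\alpha^n\in\mathcal A^n}\{V\widehat f^n(\alpha^n)+\langle\mathbf Q[t^n_k],\widehat{\mathbf g}^n(\alpha^n)\rangle\}$. The processes $y^n[t],\mathbf z^n[t]$ in the claim are those produced by this algorithm. *)

theory Defs
  imports "HOL-Probability.Probability"
begin

text \<open>Systems are indexed by the finite type \<open>'n\<close> and metrics by the finite type \<open>'l\<close>,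
  so that \<open>N = CARD('n)\<close> and \<open>L = CARD('l)\<close>.\<close>

text \<open>Outcome of one frame: its length \<open>T\<close>, and the penalties and metric vectors listed by their
  offset \<open>i < T\<close> from the first slot of the frame; the entries at offsets \<open>i \<ge> T\<close> are \<open>0\<close>.\<close>

type_synonym 'l frame = "nat \<times> (nat \<Rightarrow> real) \<times> (nat \<Rightarrow> real^'l)"

definition frame_space :: "('l::finite) frame measure" where
  "frame_space = count_space UNIV \<Otimes>\<^sub>M (\<Pi>\<^sub>M i\<in>UNIV. borel) \<Otimes>\<^sub>M (\<Pi>\<^sub>M i\<in>UNIV. borel)"

text \<open>\<open>space (actions m n)\<close> is the action set of system \<open>n\<close>; its sigma-algebra is only needed to
  speak of random actions.  \<open>frame_law m n k a\<close> is the law of the outcome of frame \<open>k\<close> of system \<open>n\<close>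
  under action \<open>a\<close>; it may depend on \<open>k\<close>, only the expectations below may not.
  \<open>ext_law m\<close> is the common law of the external vectors.\<close>

record ('n, 'l::finite, 'a) model =
  actions :: "'n \<Rightarrow> 'a measure"
  frame_law :: "'n \<Rightarrow> nat \<Rightarrow> 'a \<Rightarrow> 'l frame measure"
  ext_law :: "(real^'l) measure"

definition mean_len :: "('n, 'l::finite, 'a) model \<Rightarrow> 'n \<Rightarrow> nat \<Rightarrow> 'a \<Rightarrow> real" where
  "mean_len m n k a = (LINT (T, y, z)|frame_law m n k a. real T)"

definition mean_pen :: "('n, 'l::finite, 'a) model \<Rightarrow> 'n \<Rightarrow> nat \<Rightarrow> 'a \<Rightarrow> real" where
  "mean_pen m n k a = (LINT (T, y, z)|frame_law m n k a. (\<Sum>i<T. y i))"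

definition mean_met :: "('n, 'l::finite, 'a) model \<Rightarrow> 'n \<Rightarrow> nat \<Rightarrow> 'a \<Rightarrow> real^'l" where
  "mean_met m n k a = (\<chi> l. LINT (T, y, z)|frame_law m n k a. (\<Sum>i<T. z i $ l))"

definition renewal_model :: "('n, 'l::finite, 'a) model \<Rightarrow> bool" where
  "renewal_model m \<longleftrightarrow>
     (\<forall>n k. frame_law m n k \<in> actions m n \<rightarrow>\<^sub>M prob_algebra frame_space) \<and>
     (\<forall>n k. \<forall>a\<in>space (actions m n). AE (T, y, z) in frame_law m n k a.
        T \<ge> 1 \<and> (\<forall>i\<ge>T. y i = 0 \<and> z i = 0)) \<and>
     (\<forall>n k. \<forall>a\<in>space (actions m n).
        mean_len m n k a = mean_len m n 0 a \<and>
        mean_pen m n k a = mean_pen m n 0 a \<and>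
        mean_met m n k a = mean_met m n 0 a) \<and>
     prob_space (ext_law m) \<and> sets (ext_law m) = sets borel"

abbreviation That :: "('n, 'l::finite, 'a) model \<Rightarrow> 'n \<Rightarrow> 'a \<Rightarrow> real" where
  "That m n a \<equiv> mean_len m n 0 a"

abbreviation yhat :: "('n, 'l::finite, 'a) model \<Rightarrow> 'n \<Rightarrow> 'a \<Rightarrow> real" where
  "yhat m n a \<equiv> mean_pen m n 0 a"

abbreviation zhat :: "('n, 'l::finite, 'a) model \<Rightarrow> 'n \<Rightarrow> 'a \<Rightarrow> real^'l" where
  "zhat m n a \<equiv> mean_met m n 0 a"

definition fhat :: "('n, 'l::finite, 'a) model \<Rightarrow> 'n \<Rightarrow> 'a \<Rightarrow> real" where
  "fhat m n a = yhat m n a / That m n a"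

definition ghat :: "('n, 'l::finite, 'a) model \<Rightarrow> 'n \<Rightarrow> 'a \<Rightarrow> real^'l" where
  "ghat m n a = zhat m n a /\<^sub>R That m n a"

definition ext_mean :: "('n, 'l::finite, 'a) model \<Rightarrow> real^'l" where
  "ext_mean m = (\<chi> l. LINT x|ext_law m. x $ l)"

definition perf_S :: "('n, 'l::finite, 'a) model \<Rightarrow> 'n \<Rightarrow> (real \<times> (real^'l) \<times> real) set" where
  "perf_S m n = convex hull {(yhat m n a, zhat m n a, That m n a) |a. a \<in> space (actions m n)}"

definition perf_P :: "('n, 'l::finite, 'a) model \<Rightarrow> 'n \<Rightarrow> (real \<times> (real^'l)) set" where
  "perf_P m n = {(y / T, z /\<^sub>R T) |y z T. (y, z, T) \<in> perf_S m n}"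

text \<open>\<open>uniform_measure K S\<close> is the conditional measure of \<open>K\<close> given \<open>S\<close>.\<close>

definition bounded_model :: "('n, 'l::finite, 'a) model \<Rightarrow> bool" where
  "bounded_model m \<longleftrightarrow>
     (\<exists>ymax zmax. \<forall>n k. \<forall>a\<in>space (actions m n). AE (T, y, z) in frame_law m n k a.
        \<forall>i<T. \<bar>y i\<bar> \<le> ymax \<and> (\<forall>l. \<bar>z i $ l\<bar> \<le> zmax)) \<and>
     (\<exists>dmax. AE x in ext_law m. \<forall>l. \<bar>x $ l\<bar> \<le> dmax) \<and>
     (\<exists>B\<ge>1. \<forall>n k. \<forall>a\<in>space (actions m n). \<forall>s::nat.
        let K = frame_law m n k a; S = {w \<in> space K. fst w \<ge> s} in
        measure K S > 0 \<longrightarrow>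
        (\<integral>\<^sup>+ w. ennreal ((real (fst w) - real s)\<^sup>2) \<partial>uniform_measure K S) \<le> ennreal B)"

definition compact_model :: "('n, 'l::finite, 'a) model \<Rightarrow> bool" where
  "compact_model m \<longleftrightarrow>
     (\<forall>n. compact {(fhat m n a, ghat m n a) |a. a \<in> space (actions m n)})"

text \<open>\<open>rtime R n k\<close> is the renewal time \<open>t\<^sup>n\<^sub>k\<close>, \<open>act R n k\<close> the action \<open>\<alpha>\<^sup>n\<^sub>k\<close>, and
  \<open>pen R n t\<close>, \<open>met R n t\<close>, \<open>ext R t\<close> are \<open>y\<^sup>n[t]\<close>, \<open>z\<^sup>n[t]\<close>, \<open>d[t]\<close>.\<close>

record ('w, 'n, 'l::finite, 'a) run =
  pspace :: "'w measure"
  rtime :: "'n \<Rightarrow> nat \<Rightarrow> 'w \<Rightarrow> nat"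
  act :: "'n \<Rightarrow> nat \<Rightarrow> 'w \<Rightarrow> 'a"
  pen :: "'n \<Rightarrow> nat \<Rightarrow> 'w \<Rightarrow> real"
  met :: "'n \<Rightarrow> nat \<Rightarrow> 'w \<Rightarrow> real^'l"
  ext :: "nat \<Rightarrow> 'w \<Rightarrow> real^'l"

definition frame_len :: "('w, 'n, 'l::finite, 'a) run \<Rightarrow> 'n \<Rightarrow> nat \<Rightarrow> 'w \<Rightarrow> nat" where
  "frame_len R n k \<omega> = rtime R n (Suc k) \<omega> - rtime R n k \<omega>"

definition frame_out :: "('w, 'n, 'l::finite, 'a) run \<Rightarrow> 'n \<Rightarrow> nat \<Rightarrow> 'w \<Rightarrow> 'l frame" where
  "frame_out R n k \<omega> =
     (frame_len R n k \<omega>,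
      \<lambda>i. if i < frame_len R n k \<omega> then pen R n (rtime R n k \<omega> + i) \<omega> else 0,
      \<lambda>i. if i < frame_len R n k \<omega> then met R n (rtime R n k \<omega> + i) \<omega> else 0)"

text \<open>The sigma-algebra of all outcomes from slots before \<open>t\<close>.  A frame whose last slot is \<open>t - 1\<close>
  is complete by then, so the events \<open>t\<^sup>n\<^sub>k = s\<close> belong to it up to and including \<open>s = t\<close>.\<close>

definition past :: "('n, 'l::finite, 'a) model \<Rightarrow> ('w, 'n, 'l, 'a) run \<Rightarrow> nat \<Rightarrow> 'w measure" where
  "past m R t = (let \<Omega> = space (pspace R) in sigma \<Omega>
     ({{\<omega> \<in> \<Omega>. pen R n s \<omega> \<in> U} |n s U. s < t \<and> U \<in> sets borel} \<union>
      {{\<omega> \<in> \<Omega>. met R n s \<omega> \<in> U} |n s U. s < t \<and> U \<in> sets borel} \<union>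
      {{\<omega> \<in> \<Omega>. ext R s \<omega> \<in> U} |s U. s < t \<and> U \<in> sets borel} \<union>
      {{\<omega> \<in> \<Omega>. rtime R n k \<omega> = s} |n k s. s \<le> t} \<union>
      {{\<omega> \<in> \<Omega>. rtime R n k \<omega> = s \<and> act R n k \<omega> \<in> U} |n k s U. s < t \<and> U \<in> sets (actions m n)}))"

text \<open>The renewal property says that, given the past of the (random) slot \<open>t\<^sup>n\<^sub>k\<close> and the action
  \<open>\<alpha>\<^sup>n\<^sub>k\<close>, the outcome of frame \<open>k\<close> has law \<open>frame_law m n k (\<alpha>\<^sup>n\<^sub>k)\<close>.  It is spelled out on the
  events \<open>t\<^sup>n\<^sub>k = t\<close>.  Nothing is required of outcomes of different systems
  within overlapping frames beyond this.\<close>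

definition renewal_property :: "('n, 'l::finite, 'a) model \<Rightarrow> ('w, 'n, 'l, 'a) run \<Rightarrow> bool" where
  "renewal_property m R \<longleftrightarrow>
     (\<forall>n k t. \<forall>H\<in>sets (past m R t). \<forall>U\<in>sets (actions m n). \<forall>E\<in>sets frame_space.
        let G = {\<omega> \<in> H. rtime R n k \<omega> = t \<and> act R n k \<omega> \<in> U} in
        measure (pspace R) {\<omega> \<in> G. frame_out R n k \<omega> \<in> E} =
          (LINT \<omega>:G|pspace R. measure (frame_law m n k (act R n k \<omega>)) E))"

definition external_iid :: "('n, 'l::finite, 'a) model \<Rightarrow> ('w, 'n, 'l, 'a) run \<Rightarrow> bool" where
  "external_iid m R \<longleftrightarrow>
     prob_space.indep_vars (pspace R) (\<lambda>_. borel) (ext R) UNIV \<and>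
     (\<forall>t. distr (pspace R) borel (ext R t) = ext_law m) \<and>
     (\<forall>t. prob_space.indep_set (pspace R) (sets (past m R t))
            {{\<omega> \<in> space (pspace R). ext R t \<omega> \<in> U} |U. U \<in> sets borel})"

definition renewal_run :: "('n, 'l::finite, 'a) model \<Rightarrow> ('w, 'n, 'l, 'a) run \<Rightarrow> bool" where
  "renewal_run m R \<longleftrightarrow>
     prob_space (pspace R) \<and>
     (\<forall>n k. rtime R n k \<in> pspace R \<rightarrow>\<^sub>M count_space UNIV) \<and>
     (\<forall>n k. act R n k \<in> pspace R \<rightarrow>\<^sub>M actions m n) \<and>
     (\<forall>n t. pen R n t \<in> borel_measurable (pspace R)) \<and>
     (\<forall>n t. met R n t \<in> borel_measurable (pspace R)) \<and>
     (\<forall>t. ext R t \<in> borel_measurable (pspace R)) \<and>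
     (\<forall>n. \<forall>\<omega>\<in>space (pspace R). rtime R n 0 \<omega> = 0 \<and> strict_mono (\<lambda>k. rtime R n k \<omega>)) \<and>
     renewal_property m R \<and>
     external_iid m R"

text \<open>Decisions may be randomized and may depend on the past, but not on the future: given the past
  of slot \<open>t\<close>, the decisions taken at \<open>t\<close> are conditionally independent of what is not yet
  revealed of the frames started before \<open>t\<close> and of the external process.\<close>

definition decisions_at ::
    "('n, 'l::finite, 'a) model \<Rightarrow> ('w, 'n, 'l, 'a) run \<Rightarrow> nat \<Rightarrow> 'w measure" where
  "decisions_at m R t = (let \<Omega> = space (pspace R) in sigma \<Omega>
     {{\<omega> \<in> \<Omega>. rtime R n k \<omega> = t \<and> act R n k \<omega> \<in> U} |n k U. U \<in> sets (actions m n)})"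

definition pending :: "('w, 'n, 'l::finite, 'a) run \<Rightarrow> nat \<Rightarrow> 'w measure" where
  "pending R t = (let \<Omega> = space (pspace R) in sigma \<Omega>
     ({{\<omega> \<in> \<Omega>. rtime R n k \<omega> < t \<and> frame_out R n k \<omega> \<in> E} |n k E. E \<in> sets frame_space} \<union>
      {{\<omega> \<in> \<Omega>. ext R s \<omega> \<in> U} |s U. s \<ge> t \<and> U \<in> sets borel}))"

definition nonanticipating :: "('n, 'l::finite, 'a) model \<Rightarrow> ('w, 'n, 'l, 'a) run \<Rightarrow> bool" where
  "nonanticipating m R \<longleftrightarrow>
     (\<forall>t. \<forall>A\<in>sets (decisions_at m R t). \<forall>E\<in>sets (pending R t).
        let P = (\<lambda>X. real_cond_exp (pspace R) (past m R t) (indicator X)) in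
        AE \<omega> in pspace R. P (A \<inter> E) \<omega> = P A \<omega> * P E \<omega>)"

definition avg_pen :: "('w, 'n::finite, 'l::finite, 'a) run \<Rightarrow> nat \<Rightarrow> real" where
  "avg_pen R T = (1 / real T) * (\<Sum>t<T. \<Sum>n\<in>UNIV. LINT \<omega>|pspace R. pen R n t \<omega>)"

definition avg_met :: "('w, 'n::finite, 'l::finite, 'a) run \<Rightarrow> 'l \<Rightarrow> nat \<Rightarrow> real" where
  "avg_met R l T = (1 / real T) * (\<Sum>t<T. \<Sum>n\<in>UNIV. LINT \<omega>|pspace R. met R n t \<omega> $ l)"

definition admissible :: "('n::finite, 'l::finite, 'a) model \<Rightarrow> ('w, 'n, 'l, 'a) run \<Rightarrow> bool" where
  "admissible m R \<longleftrightarrow>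
     renewal_run m R \<and> nonanticipating m R \<and>
     (\<forall>l. limsup (\<lambda>T. ereal (avg_met R l T)) \<le> ereal (ext_mean m $ l))"

text \<open>A run consists of the renewal times, actions, penalties, metrics and external vectors, and all
  conditions above concern the joint law of these only.  Hence, in the optimization problem, it is
  no restriction to take the type of all trajectories as sample space.\<close>

type_synonym ('n, 'l, 'a) trajectory =
  "('n \<Rightarrow> nat \<Rightarrow> nat) \<times> ('n \<Rightarrow> nat \<Rightarrow> 'a) \<times> ('n \<Rightarrow> nat \<Rightarrow> real) \<times> ('n \<Rightarrow> nat \<Rightarrow> real^'l) \<times> (nat \<Rightarrow> real^'l)"

definition feasible :: "('n::finite, 'l::finite, 'a) model \<Rightarrow> bool" where
  "feasible m \<longleftrightarrow>
     (\<exists>R :: (('n, 'l, 'a) trajectory, 'n, 'l, 'a) run. admissible m R)"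

definition f_star :: "('n::finite, 'l::finite, 'a) model \<Rightarrow> ereal" where
  "f_star m = Inf {limsup (\<lambda>T. ereal (avg_pen R T)) |
     R :: (('n, 'l, 'a) trajectory, 'n, 'l, 'a) run. admissible m R}"

primrec queue :: "('w, 'n::finite, 'l::finite, 'a) run \<Rightarrow> nat \<Rightarrow> 'w \<Rightarrow> real^'l" where
  "queue R 0 \<omega> = 0"
| "queue R (Suc t) \<omega> =
     (\<chi> l. max (queue R t \<omega> $ l + (\<Sum>n\<in>UNIV. met R n t \<omega> $ l) - ext R t \<omega> $ l) 0)"

definition follows_algorithm ::
    "('n::finite, 'l::finite, 'a) model \<Rightarrow> real \<Rightarrow> ('w, 'n, 'l, 'a) run \<Rightarrow> bool" where
  "follows_algorithm m V R \<longleftrightarrow>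
     (\<forall>n k. \<exists>\<phi> :: real^'l \<Rightarrow> 'a. \<forall>\<omega>\<in>space (pspace R).
        let Q = queue R (rtime R n k \<omega>) \<omega>; \<alpha> = act R n k \<omega> in
        \<alpha> = \<phi> Q \<and>
        (\<forall>a\<in>space (actions m n).
           V * fhat m n \<alpha> + Q \<bullet> ghat m n \<alpha> \<le> V * fhat m n a + Q \<bullet> ghat m n a))"

end

theory Submission
  imports Defs
begin

text \<open>The proof is a Lyapunov drift argument in which the comparison with the optimum goes through
  Lagrangian weak duality.  For a penalty weight \<open>V\<close> and metric weights \<open>q\<close> let \<open>min_cost n V q\<close> be
  the infimum of \<open>V * fhat + q \<bullet> ghat\<close> over the actions of system \<open>n\<close>: the least weighted cost per
  slot that the system can sustain.  Three facts carry the proof.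

  Renewal reward (\<open>renewal_reward_le\<close>).  Let the weights be frozen in each frame at values known at
  its start, and let \<open>\<theta>\<close>, also known at the start, be such that the conditional mean cost of the
  frame is at most \<open>\<theta>\<close> times its conditional mean length.  Then the sum of cost minus \<open>\<theta>\<close> over whole
  frames has nonpositive expectation.  Passing to the slots before a deterministic time \<open>T\<close> with
  weights that follow the slots makes two errors.  The frame in progress at \<open>T\<close> overshoots, but its
  residual length has mean at most \<open>B\<close> by the residual moment condition.  The weights move inside a
  frame, by an amount proportional to the age of the frame, so the total error is of the order of the
  sum of the squared frame lengths, which is at most \<open>B\<close> per frame in expectation.  The second error
  is also the price for adding up systems whose frames are not aligned: afterwards all systems
  are weighted by the queues of the same slot.

  Weak duality (\<open>weak_duality\<close>).  With constant weights and reversed signs, the renewal-reward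
  inequality bounds \<open>V\<close> times the average penalty plus \<open>q\<close> times the average metrics of every run from
  below by the sum of the \<open>min_cost n V q\<close>, up to \<open>O(1/T)\<close>.  For admissible runs the average metrics are
  asymptotically at most \<open>d\<close>, hence that sum is at most \<open>V * f\<^sub>* + q \<bullet> d\<close> for all \<open>V > 0\<close> and \<open>q \<ge> 0\<close>.

  Drift (\<open>drift_plus_penalty\<close>).  The square of the queues increases by at most
  twice the inner product of the queue vector with its increment, up to a constant per slot.  The
  algorithm attains \<open>min_cost n V (Q[t])\<close>, so the renewal-reward inequality with the queues as weights
  and weak duality at \<open>(V, Q[t])\<close> give
  \<open>E |Q[T]|\<^sup>2 / 2 + V * T * (average penalty - f\<^sub>*) \<le> K * (V + T)\<close>.
  Here the overshoot error is controlled by the crude bound \<open>Q[T] = O(T)\<close>.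

  Dropping the square and dividing by \<open>V * T\<close> yields the penalty bound.  For the metrics, the
  multiplier condition says that the sum of the \<open>min_cost n 1 \<gamma>\<close> is at least \<open>f\<^sub>* + \<gamma> \<bullet> d\<close>; the lower
  bound with weights \<open>(1, \<gamma>)\<close> shows that the penalty cannot fall below \<open>f\<^sub>*\<close> by more than
  \<open>\<gamma> \<bullet> E Q[T] / T\<close>, up to \<open>O(1/T)\<close>.  Inserted into the drift inequality this is a quadratic inequality for \<open>E Q[T]\<close>,
  whose solutions are \<open>O(sqrt T)\<close> once \<open>T \<ge> V\<^sup>2\<close>.  Since the queue dominates the accumulated
  constraint violation, the average metrics exceed \<open>d\<close> by at most \<open>E Q[T] / T = O(\<epsilon>)\<close>.\<close>

section \<open>Frames and their moments\<close>

lemma space_frame_space [simp]: "space (frame_space :: ('l::finite) frame measure) = UNIV"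
  by (simp add: frame_space_def space_pair_measure space_PiM PiE_UNIV_domain)

lemma frame_measurable [measurable]:
  "fst \<in> frame_space \<rightarrow>\<^sub>M count_space UNIV"
  "(\<lambda>w. fst (snd w) i) \<in> borel_measurable frame_space"
  "(\<lambda>w. snd (snd w) i) \<in> borel_measurable (frame_space :: ('l::finite) frame measure)"
  unfolding frame_space_def by measurable

lemma vec_nth_measurable [measurable]:
  "f \<in> borel_measurable M \<Longrightarrow> (\<lambda>x. (f x :: real^'l::finite) $ l) \<in> borel_measurable M"
  by (erule measurable_compose) (intro borel_measurable_continuous_onI continuous_intros)

definition pen_sum :: "('l::finite) frame \<Rightarrow> real" where
  "pen_sum w = (\<Sum>i<fst w. fst (snd w) i)"

definition met_sum :: "'l \<Rightarrow> ('l::finite) frame \<Rightarrow> real" where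
  "met_sum l w = (\<Sum>i<fst w. snd (snd w) i $ l)"

lemma sum_measurable [measurable]:
  "pen_sum \<in> borel_measurable (frame_space :: ('l::finite) frame measure)"
  "met_sum l \<in> borel_measurable (frame_space :: 'l frame measure)"
proof -
  have "(\<lambda>w :: 'l frame. (\<lambda>n w. \<Sum>i<n. fst (snd w) i) (fst w) w) \<in> borel_measurable frame_space"
    by (rule measurable_compose_countable) measurable
  then show "(pen_sum :: 'l frame \<Rightarrow> real) \<in> borel_measurable frame_space"
    by (simp add: pen_sum_def[abs_def])
  have "(\<lambda>w :: 'l frame. (\<lambda>n w. \<Sum>i<n. snd (snd w) i $ l) (fst w) w) \<in> borel_measurable frame_space"
    by (rule measurable_compose_countable) measurable
  then show "met_sum l \<in> borel_measurable (frame_space :: 'l frame measure)"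
    by (simp add: met_sum_def[abs_def])
qed

text \<open>A model with explicit constants for its bounds.  The set \<open>{w. s \<le> fst w}\<close> is the event that the frame
  lasts at least \<open>s\<close> slots.\<close>

locale bounded_renewal =
  fixes m :: "('n::finite, 'l::finite, 'a) model" and Y Z D B :: real
  assumes model: "renewal_model m"
    and Y_nonneg: "0 \<le> Y" and Z_nonneg: "0 \<le> Z" and D_nonneg: "0 \<le> D" and B_ge_1: "1 \<le> B"
    and frame_bounds: "\<And>n k a. a \<in> space (actions m n) \<Longrightarrow>
      AE w in frame_law m n k a. \<forall>i<fst w. \<bar>fst (snd w) i\<bar> \<le> Y \<and> (\<forall>l. \<bar>snd (snd w) i $ l\<bar> \<le> Z)"
    and ext_bound: "AE x in ext_law m. \<forall>l. \<bar>x $ l\<bar> \<le> D"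
    and residual_moment: "\<And>n k a s. a \<in> space (actions m n) \<Longrightarrow>
      measure (frame_law m n k a) {w. s \<le> fst w} > 0 \<Longrightarrow>
      (\<integral>\<^sup>+ w. ennreal ((real (fst w) - real s)\<^sup>2)
        \<partial>uniform_measure (frame_law m n k a) {w. s \<le> fst w}) \<le> ennreal B"
begin

context
  fixes n :: 'n and k :: nat and a :: 'a
  assumes a: "a \<in> space (actions m n)"
begin

lemma law_in: "frame_law m n k a \<in> space (prob_algebra frame_space)"
  using model a measurable_space[of "frame_law m n k" "actions m n"]
  unfolding renewal_model_def by blast

lemma prob_space_law: "prob_space (frame_law m n k a)"
  and sets_law [measurable_cong]: "sets (frame_law m n k a) = sets frame_space"
  using law_in by (auto simp: space_prob_algebra)

lemma space_law: "space (frame_law m n k a) = UNIV"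
  using sets_eq_imp_space_eq[OF sets_law] by simp

interpretation K: prob_space "frame_law m n k a" by (rule prob_space_law)

lemma measurable_law: "f \<in> measurable frame_space N \<Longrightarrow> f \<in> measurable (frame_law m n k a) N"
  using measurable_cong_sets[OF sets_law refl] by blast

lemma len_ge_sets: "{w. s \<le> fst w} \<in> sets (frame_law m n k a)"
proof -
  have "{w \<in> space frame_space. s \<le> fst w} \<in> sets (frame_space :: 'l frame measure)" by measurable
  then show ?thesis by (simp add: sets_law)
qed

text \<open>The conditional moment bound, multiplied by the probability of the condition.  In this form it
  also holds when that probability is zero.\<close>

lemma nn_residual_le:
  "(\<integral>\<^sup>+ w. ennreal ((real (fst w) - real s)\<^sup>2) * indicator {w. s \<le> fst w} w \<partial>frame_law m n k a)
    \<le> ennreal (B * measure (frame_law m n k a) {w. s \<le> fst w})" (is "?L \<le> _")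
proof (cases "measure (frame_law m n k a) {w. s \<le> fst w} > 0")
  case True
  let ?K = "frame_law m n k a" and ?S = "{w :: 'l frame. s \<le> fst w}"
  have m1: "(\<lambda>w. ennreal ((real (fst w) - real s)\<^sup>2)) \<in> borel_measurable ?K"
    by (rule measurable_law) measurable
  have "?L / emeasure ?K ?S \<le> ennreal B"
    using residual_moment[OF a True] nn_integral_uniform_measure[OF m1 len_ge_sets] by simp
  then have "?L / emeasure ?K ?S * emeasure ?K ?S \<le> ennreal B * emeasure ?K ?S"
    by (rule mult_right_mono) simp
  also have "?L / emeasure ?K ?S * emeasure ?K ?S = ?L"
    using True by (simp add: K.emeasure_eq_measure ennreal_divide_times)
  finally show ?thesis
    using B_ge_1 by (simp add: K.emeasure_eq_measure ennreal_mult)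
next
  case False
  then have "emeasure (frame_law m n k a) {w. s \<le> fst w} = 0"
    by (simp add: K.emeasure_eq_measure zero_less_measure_iff)
  then have "AE w in frame_law m n k a. w \<notin> {w. s \<le> fst w}"
    using len_ge_sets by (simp add: AE_iff_null null_setsI Int_def Collect_neg_eq space_law)
  then have "?L = (\<integral>\<^sup>+ w. 0 \<partial>frame_law m n k a)"
    by (intro nn_integral_cong_AE) auto
  then show ?thesis by simp
qed

lemma len_sq_integrable: "integrable (frame_law m n k a) (\<lambda>w. (real (fst w))\<^sup>2)"
  and len_sq_mean_le: "(LINT w|frame_law m n k a. (real (fst w))\<^sup>2) \<le> B"
proof -
  have *: "(\<integral>\<^sup>+ w. ennreal ((real (fst w))\<^sup>2) \<partial>frame_law m n k a) \<le> ennreal B"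
    using nn_residual_le[of 0] K.prob_space by (simp add: space_law)
  have m1: "(\<lambda>w. (real (fst w))\<^sup>2) \<in> borel_measurable (frame_law m n k a)"
    by (rule measurable_law) measurable
  show i: "integrable (frame_law m n k a) (\<lambda>w. (real (fst w))\<^sup>2)"
    by (rule integrableI_nonneg[OF m1]) (use * in \<open>auto simp: ennreal_less_top le_less_trans\<close>)
  show "(LINT w|frame_law m n k a. (real (fst w))\<^sup>2) \<le> B"
    using * nn_integral_eq_integral[OF i] B_ge_1 by (simp add: ennreal_le_iff)
qed

text \<open>The residual length beyond \<open>s\<close> is a natural number, hence at most its square, and vanishes unless
  the frame reaches \<open>s\<close>.  Keeping the survival probability on the right is what allows summing over
  the frames: exactly one of them survives to a given time.\<close>

lemma residual_mean_le:
  "(LINT w|frame_law m n k a. max (real (fst w) - real s) 0)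
    \<le> B * measure (frame_law m n k a) {w. s \<le> fst w}"
proof -
  have le: "ennreal (max (real (fst w) - real s) 0)
      \<le> ennreal ((real (fst w) - real s)\<^sup>2) * indicator {w. s \<le> fst w} w" for w :: "'l frame"
  proof (cases "s \<le> fst w")
    case True
    then have "real (fst w) - real s = 0 \<or> real (fst w) - real s \<ge> 1" by auto
    then have "max (real (fst w) - real s) 0 \<le> (real (fst w) - real s)\<^sup>2"
      by (auto simp: power2_eq_square intro!: mult_le_cancel_left1[THEN iffD2])
    with True show ?thesis by (simp add: ennreal_leI)
  qed auto
  have m1: "(\<lambda>w. max (real (fst w) - real s) 0) \<in> borel_measurable (frame_law m n k a)"
    by (rule measurable_law) measurable
  have "ennreal (LINT w|frame_law m n k a. max (real (fst w) - real s) 0)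
      = (\<integral>\<^sup>+ w. ennreal (max (real (fst w) - real s) 0) \<partial>frame_law m n k a)"
  proof (rule nn_integral_eq_integral[symmetric])
    show "integrable (frame_law m n k a) (\<lambda>w. max (real (fst w) - real s) 0)"
    proof (rule Bochner_Integration.integrable_bound[OF len_sq_integrable m1], rule AE_I2)
      fix w :: "'l frame"
      have "max (real (fst w) - real s) 0 \<le> real (fst w)" by simp
      also have "\<dots> \<le> (real (fst w))\<^sup>2"
        by (cases "fst w") (auto simp: power2_eq_square)
      finally show "norm (max (real (fst w) - real s) 0) \<le> norm ((real (fst w))\<^sup>2)" by simp
    qed
  qed simp
  also have "\<dots> \<le> (\<integral>\<^sup>+ w. ennreal ((real (fst w) - real s)\<^sup>2) * indicator {w. s \<le> fst w} w \<partial>frame_law m n k a)"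
    by (intro nn_integral_mono le)
  also have "\<dots> \<le> ennreal (B * measure (frame_law m n k a) {w. s \<le> fst w})"
    by (rule nn_residual_le)
  finally show ?thesis using B_ge_1 by (simp add: ennreal_le_iff)
qed

lemma AE_len_ge_1: "AE w in frame_law m n k a. 1 \<le> fst w"
proof -
  have "AE (T, y, z) in frame_law m n k a. T \<ge> 1 \<and> (\<forall>i\<ge>T. y i = 0 \<and> z i = 0)"
    using model a unfolding renewal_model_def by blast
  then show ?thesis by eventually_elim auto
qed

end

end

section \<open>Conditioning on the past of a renewal time\<close>

locale bounded_run = bounded_renewal m Y Z D B
  for m :: "('n::finite, 'l::finite, 'a) model" and Y Z D B +
  fixes R :: "('w, 'n, 'l, 'a) run"
  assumes run: "renewal_run m R"
begin

sublocale P: prob_space "pspace R"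
  using run unfolding renewal_run_def by blast

lemma run_measurable [measurable]:
  "rtime R n k \<in> pspace R \<rightarrow>\<^sub>M count_space UNIV"
  "act R n k \<in> pspace R \<rightarrow>\<^sub>M actions m n"
  "pen R n t \<in> borel_measurable (pspace R)"
  "met R n t \<in> borel_measurable (pspace R)"
  "ext R t \<in> borel_measurable (pspace R)"
  using run unfolding renewal_run_def by blast+

lemma rtime_0: "\<omega> \<in> space (pspace R) \<Longrightarrow> rtime R n 0 \<omega> = 0"
  and rtime_strict_mono: "\<omega> \<in> space (pspace R) \<Longrightarrow> strict_mono (\<lambda>k. rtime R n k \<omega>)"
  using run unfolding renewal_run_def by blast+

lemma act_in: "\<omega> \<in> space (pspace R) \<Longrightarrow> act R n k \<omega> \<in> space (actions m n)"
  using measurable_space[OF run_measurable(2)] .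

lemma frame_len_measurable [measurable]: "frame_len R n k \<in> pspace R \<rightarrow>\<^sub>M count_space UNIV"
  unfolding frame_len_def[abs_def] by measurable

lemma frame_out_measurable [measurable]: "frame_out R n k \<in> pspace R \<rightarrow>\<^sub>M frame_space"
proof -
  have [measurable]: "(\<lambda>\<omega>. (\<lambda>s. pen R n (s + i)) (rtime R n k \<omega>) \<omega>) \<in> borel_measurable (pspace R)" for i
    by (rule measurable_compose_countable) measurable
  have [measurable]: "(\<lambda>\<omega>. (\<lambda>s. met R n (s + i)) (rtime R n k \<omega>) \<omega>) \<in> borel_measurable (pspace R)" for i
    by (rule measurable_compose_countable) measurable
  show ?thesis
    unfolding frame_out_def[abs_def] frame_space_def
    by (intro measurable_Pair measurable_PiM_single') (auto simp: space_PiM)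
qed

lemma kernel_measurable:
  "(\<lambda>\<omega>. frame_law m n k (act R n k \<omega>)) \<in> pspace R \<rightarrow>\<^sub>M subprob_algebra frame_space"
proof -
  have "frame_law m n k \<in> actions m n \<rightarrow>\<^sub>M prob_algebra frame_space"
    using model unfolding renewal_model_def by blast
  from measurable_compose[OF run_measurable(2) measurable_prob_algebraD[OF this]] show ?thesis .
qed

lemma space_past [simp]: "space (past m R t) = space (pspace R)"
  by (auto simp: past_def Let_def intro!: space_measure_of)

lemma past_gens:
  shows met_past: "s < t \<Longrightarrow> met R n s \<in> borel_measurable (past m R t)"
    and ext_past: "s < t \<Longrightarrow> ext R s \<in> borel_measurable (past m R t)"
    and past_subalgebra: "subalgebra (pspace R) (past m R t)"
proof -
  let ?\<Omega> = "space (pspace R)"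
  let ?G = "{{\<omega> \<in> ?\<Omega>. pen R n s \<omega> \<in> U} |n s U. s < t \<and> U \<in> sets borel} \<union>
      {{\<omega> \<in> ?\<Omega>. met R n s \<omega> \<in> U} |n s U. s < t \<and> U \<in> sets borel} \<union>
      {{\<omega> \<in> ?\<Omega>. ext R s \<omega> \<in> U} |s U. s < t \<and> U \<in> sets borel} \<union>
      {{\<omega> \<in> ?\<Omega>. rtime R n k \<omega> = s} |n k s. s \<le> t} \<union>
      {{\<omega> \<in> ?\<Omega>. rtime R n k \<omega> = s \<and> act R n k \<omega> \<in> U} |n k s U. s < t \<and> U \<in> sets (actions m n)}"
  have sub: "?G \<subseteq> Pow ?\<Omega>" by auto
  have sets: "sets (past m R t) = sigma_sets ?\<Omega> ?G"
    unfolding past_def Let_def using sub by (rule sets_measure_of)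
  have g2: "s < t \<Longrightarrow> U \<in> sets borel \<Longrightarrow> {\<omega> \<in> ?\<Omega>. met R n s \<omega> \<in> U} \<in> sets (past m R t)" for n s U
    unfolding sets
    by (rule sigma_sets.Basic, rule UnI1, rule UnI1, rule UnI1, rule UnI2, intro CollectI exI conjI, rule refl) assumption+
  have g3: "s < t \<Longrightarrow> U \<in> sets borel \<Longrightarrow> {\<omega> \<in> ?\<Omega>. ext R s \<omega> \<in> U} \<in> sets (past m R t)" for s U
    unfolding sets
    by (rule sigma_sets.Basic, rule UnI1, rule UnI1, rule UnI2, intro CollectI exI conjI, rule refl) assumption+
  show "met R n s \<in> borel_measurable (past m R t)" if "s < t"
    by (rule measurableI) (use g2[OF that] in \<open>simp_all add: vimage_def Int_def conj_commute\<close>)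
  show "ext R s \<in> borel_measurable (past m R t)" if "s < t"
    by (rule measurableI) (use g3[OF that] in \<open>simp_all add: vimage_def Int_def conj_commute\<close>)
  have "?G \<subseteq> sets (pspace R)"
  proof -
    have h1: "{\<omega> \<in> ?\<Omega>. pen R n s \<omega> \<in> U} \<in> sets (pspace R)"
      if [measurable]: "U \<in> sets borel" for n s U by measurable
    have h2: "{\<omega> \<in> ?\<Omega>. met R n s \<omega> \<in> U} \<in> sets (pspace R)"
      if [measurable]: "U \<in> sets borel" for n s U by measurable
    have h3: "{\<omega> \<in> ?\<Omega>. ext R s \<omega> \<in> U} \<in> sets (pspace R)"
      if [measurable]: "U \<in> sets borel" for s U by measurable
    have h4: "{\<omega> \<in> ?\<Omega>. rtime R n k \<omega> = s} \<in> sets (pspace R)" for n k s by measurable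
    have h5: "{\<omega> \<in> ?\<Omega>. rtime R n k \<omega> = s \<and> act R n k \<omega> \<in> U} \<in> sets (pspace R)"
      if [measurable]: "U \<in> sets (actions m n)" for n k s U by measurable
    show ?thesis
      by (intro Un_least subsetI; elim CollectE exE conjE; hypsubst; (rule h1 h2 h3 h4 h5; assumption?))
  qed
  then have "sigma_sets ?\<Omega> ?G \<subseteq> sets (pspace R)"
    by (rule sets.sigma_sets_subset)
  then show "subalgebra (pspace R) (past m R t)"
    by (simp only: subalgebra_def sets space_past)
qed

lemma past_measurable: "f \<in> measurable (past m R t) N \<Longrightarrow> f \<in> measurable (pspace R) N"
  using measurable_from_subalg[OF past_subalgebra] .

abbreviation starts :: "'n \<Rightarrow> nat \<Rightarrow> nat \<Rightarrow> 'w set" where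
  "starts n k t \<equiv> {\<omega> \<in> space (pspace R). rtime R n k \<omega> = t}"

lemma renewal: "renewal_property m R"
  using run unfolding renewal_run_def by blast

text \<open>The renewal property speaks of probabilities only.  Both sides are integrals over \<open>\<phi>\<close> with respect
  to measures on frames, the law of the outcome and the mixture of the frame laws, each restricted
  to the event that the frame starts at \<open>t\<close>; the renewal property says that these measures agree.\<close>

lemma frame_out_nn_integral:
  assumes H: "H \<in> sets (past m R t)" and \<phi>: "\<phi> \<in> borel_measurable frame_space"
  shows "(\<integral>\<^sup>+\<omega>. indicator (H \<inter> starts n k t) \<omega> * \<phi> (frame_out R n k \<omega>) \<partial>pspace R) =
    (\<integral>\<^sup>+\<omega>. indicator (H \<inter> starts n k t) \<omega> * (\<integral>\<^sup>+w. \<phi> w \<partial>frame_law m n k (act R n k \<omega>)) \<partial>pspace R)"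
proof -
  let ?J = "H \<inter> starts n k t"
  let ?K = "\<lambda>\<omega>. frame_law m n k (act R n k \<omega>)"
  let ?D = "density (pspace R) (indicator ?J)"
  have Hs: "H \<in> sets (pspace R)" "H \<subseteq> space (pspace R)"
    using H past_subalgebra sets.sets_into_space[OF H] unfolding subalgebra_def by auto
  have J [measurable]: "?J \<in> sets (pspace R)" using Hs by measurable
  have K: "?K \<in> ?D \<rightarrow>\<^sub>M subprob_algebra frame_space"
    using kernel_measurable by simp
  have eq: "distr ?D frame_space (frame_out R n k) = ?D \<bind> ?K"
  proof (rule measure_eqI)
    show "sets (distr ?D frame_space (frame_out R n k)) = sets (?D \<bind> ?K)"
      using sets_bind[of ?D ?K frame_space] subprob_measurableD(2)[OF K] P.not_empty by simp
  next
    fix E assume "E \<in> sets (distr ?D frame_space (frame_out R n k))"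
    then have E [measurable]: "E \<in> sets frame_space" by simp
    have G: "{\<omega> \<in> H. rtime R n k \<omega> = t \<and> act R n k \<omega> \<in> space (actions m n)} = ?J"
      using Hs act_in by auto
    have rp: "measure (pspace R) {\<omega> \<in> ?J. frame_out R n k \<omega> \<in> E} =
        (LINT \<omega>:?J|pspace R. measure (?K \<omega>) E)"
      using renewal[unfolded renewal_property_def Let_def, rule_format, OF H sets.top E, of n k]
      unfolding G .
    have Km: "(\<lambda>\<omega>. measure (?K \<omega>) E) \<in> borel_measurable (pspace R)"
      using measurable_compose[OF kernel_measurable measurable_measure_subprob_algebra[OF E]] .
    have p1: "measure (?K \<omega>) E \<le> 1" "emeasure (?K \<omega>) E = ennreal (measure (?K \<omega>) E)"
      if "\<omega> \<in> space (pspace R)" for \<omega>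
    proof -
      interpret K: prob_space "?K \<omega>" using prob_space_law[OF act_in[OF that]] .
      show "measure (?K \<omega>) E \<le> 1" "emeasure (?K \<omega>) E = ennreal (measure (?K \<omega>) E)"
        by (simp_all add: K.emeasure_eq_measure)
    qed
    have "emeasure (distr ?D frame_space (frame_out R n k)) E
        = emeasure ?D (frame_out R n k -` E \<inter> space (pspace R))"
      by (subst emeasure_distr) auto
    also have "\<dots> = emeasure (pspace R) {\<omega> \<in> ?J. frame_out R n k \<omega> \<in> E}"
    proof -
      have A [measurable]: "frame_out R n k -` E \<inter> space (pspace R) \<in> sets (pspace R)"
        by (rule measurable_sets[OF frame_out_measurable E])
      have "emeasure ?D (frame_out R n k -` E \<inter> space (pspace R)) =
          (\<integral>\<^sup>+\<omega>. indicator {\<omega> \<in> ?J. frame_out R n k \<omega> \<in> E} \<omega> \<partial>pspace R)"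
        by (subst emeasure_density[OF borel_measurable_indicator[OF J] A])
          (auto intro!: nn_integral_cong simp: indicator_def)
      moreover have "{\<omega> \<in> ?J. frame_out R n k \<omega> \<in> E} \<in> sets (pspace R)"
      proof -
        have "{\<omega> \<in> ?J. frame_out R n k \<omega> \<in> E} = ?J \<inter> (frame_out R n k -` E \<inter> space (pspace R))"
          by auto
        then show ?thesis using sets.Int[OF J A] by simp
      qed
      ultimately show ?thesis by simp
    qed
    also have "\<dots> = ennreal (LINT \<omega>:?J|pspace R. measure (?K \<omega>) E)"
      by (simp only: P.emeasure_eq_measure rp)
    also have "\<dots> = (\<integral>\<^sup>+\<omega>. ennreal (indicator ?J \<omega> *\<^sub>R measure (?K \<omega>) E) \<partial>pspace R)"
      unfolding set_lebesgue_integral_def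
    proof (rule nn_integral_eq_integral[symmetric])
      show "integrable (pspace R) (\<lambda>\<omega>. indicator ?J \<omega> *\<^sub>R measure (?K \<omega>) E)"
      proof (rule P.integrable_const_bound[where B=1])
        show "AE \<omega> in pspace R. norm (indicator ?J \<omega> *\<^sub>R measure (?K \<omega>) E) \<le> 1"
          using p1 by (auto simp: indicator_def)
        show "(\<lambda>\<omega>. indicator ?J \<omega> *\<^sub>R measure (?K \<omega>) E) \<in> borel_measurable (pspace R)"
          by (intro borel_measurable_scaleR borel_measurable_indicator J Km)
      qed
    qed auto
    also have "\<dots> = (\<integral>\<^sup>+\<omega>. indicator ?J \<omega> * emeasure (?K \<omega>) E \<partial>pspace R)"
      by (intro nn_integral_cong) (auto simp: indicator_def p1)
    also have "\<dots> = (\<integral>\<^sup>+\<omega>. emeasure (?K \<omega>) E \<partial>?D)"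
      by (subst nn_integral_density)
        (use measurable_compose[OF kernel_measurable measurable_emeasure_subprob_algebra[OF E]] in auto)
    also have "\<dots> = emeasure (?D \<bind> ?K) E"
      by (rule emeasure_bind[OF _ K E, symmetric]) (use P.not_empty in simp)
    finally show "emeasure (distr ?D frame_space (frame_out R n k)) E = emeasure (?D \<bind> ?K) E" .
  qed
  have "(\<integral>\<^sup>+\<omega>. indicator ?J \<omega> * \<phi> (frame_out R n k \<omega>) \<partial>pspace R)
      = (\<integral>\<^sup>+w. \<phi> w \<partial>distr ?D frame_space (frame_out R n k))"
    using \<phi> by (simp add: nn_integral_distr nn_integral_density)
  also have "\<dots> = (\<integral>\<^sup>+\<omega>. \<integral>\<^sup>+w. \<phi> w \<partial>?K \<omega> \<partial>?D)"
    unfolding eq by (rule nn_integral_bind[OF \<phi> K])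
  also have "\<dots> = (\<integral>\<^sup>+\<omega>. indicator ?J \<omega> * (\<integral>\<^sup>+w. \<phi> w \<partial>?K \<omega>) \<partial>pspace R)"
    by (subst nn_integral_density)
      (use measurable_compose[OF kernel_measurable nn_integral_measurable_subprob_algebra[OF \<phi>]] in auto)
  finally show ?thesis .
qed

text \<open>Properties that hold almost surely under every frame law are inherited by the actual frames, as
  there are only countably many possible starting times.\<close>

lemma AE_frame_out:
  assumes Q [measurable]: "Q \<in> frame_space \<rightarrow>\<^sub>M count_space UNIV"
    and ae: "\<And>a. a \<in> space (actions m n) \<Longrightarrow> AE w in frame_law m n k a. Q w"
  shows "AE \<omega> in pspace R. Q (frame_out R n k \<omega>)"
proof -
  let ?N = "{w. \<not> Q w}"
  have N [measurable]: "?N \<in> sets (frame_space :: 'l frame measure)"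
  proof -
    have "{w \<in> space frame_space. \<not> Q w} \<in> sets (frame_space :: 'l frame measure)" by measurable
    then show ?thesis by simp
  qed
  have "AE \<omega> in pspace R. rtime R n k \<omega> = t \<longrightarrow> Q (frame_out R n k \<omega>)" for t
  proof -
    have z: "(\<integral>\<^sup>+w. indicator ?N w \<partial>frame_law m n k (act R n k \<omega>)) = 0"
      if "\<omega> \<in> space (pspace R)" for \<omega>
    proof -
      have "(\<integral>\<^sup>+w. indicator ?N w \<partial>frame_law m n k (act R n k \<omega>))
          = (\<integral>\<^sup>+w. 0 \<partial>frame_law m n k (act R n k \<omega>))"
        using ae[OF act_in[OF that, of n k]] by (intro nn_integral_cong_AE) auto
      then show ?thesis by simp
    qed
    have "(\<integral>\<^sup>+\<omega>. indicator (space (pspace R) \<inter> starts n k t) \<omega> * indicator ?N (frame_out R n k \<omega>) \<partial>pspace R)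
        = (\<integral>\<^sup>+\<omega>. indicator (space (pspace R) \<inter> starts n k t) \<omega> *
            (\<integral>\<^sup>+w. indicator ?N w \<partial>frame_law m n k (act R n k \<omega>)) \<partial>pspace R)"
      by (rule frame_out_nn_integral) (use sets.top[of "past m R t"] in auto)
    also have "\<dots> = (\<integral>\<^sup>+\<omega>. 0 \<partial>pspace R)"
      by (intro nn_integral_cong) (simp add: z)
    finally have "AE \<omega> in pspace R.
        indicator (space (pspace R) \<inter> starts n k t) \<omega> * indicator ?N (frame_out R n k \<omega>) = (0::ennreal)"
      using nn_integral_0_iff_AE[of "\<lambda>\<omega>. indicator (space (pspace R) \<inter> starts n k t) \<omega> *
        indicator ?N (frame_out R n k \<omega>)" "pspace R"] by simp
    with AE_space show ?thesis by eventually_elim (auto simp: indicator_def split: if_splits)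
  qed
  then have "AE \<omega> in pspace R. \<forall>t. rtime R n k \<omega> = t \<longrightarrow> Q (frame_out R n k \<omega>)"
    by (intro AE_all_countable[THEN iffD2] allI)
  then show ?thesis by eventually_elim auto
qed

end

context bounded_renewal
begin

text \<open>The frame functionals to be integrated: penalties and metrics grow linearly and the age error
  quadratically in the frame length, whose second moment is at most \<open>B\<close>.\<close>

definition quadratic_on_frames :: "'n \<Rightarrow> real \<Rightarrow> ('l frame \<Rightarrow> real) \<Rightarrow> bool" where
  "quadratic_on_frames n c \<phi> \<longleftrightarrow> 0 \<le> c \<and> \<phi> \<in> borel_measurable frame_space \<and>
     (\<forall>k. \<forall>a\<in>space (actions m n). AE w in frame_law m n k a. \<bar>\<phi> w\<bar> \<le> c * (real (fst w))\<^sup>2)"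

lemma quadratic_integrable:
  assumes q: "quadratic_on_frames n c \<phi>" and a: "a \<in> space (actions m n)"
  shows "integrable (frame_law m n k a) \<phi>"
    and "\<bar>LINT w|frame_law m n k a. \<phi> w\<bar> \<le> c * B"
proof -
  let ?K = "frame_law m n k a"
  have ae: "AE w in ?K. \<bar>\<phi> w\<bar> \<le> c * (real (fst w))\<^sup>2" and c: "0 \<le> c"
    and \<phi>: "\<phi> \<in> borel_measurable ?K"
    using q a measurable_law[OF a] unfolding quadratic_on_frames_def by blast+
  have i2: "integrable ?K (\<lambda>w. c * (real (fst w))\<^sup>2)"
    using len_sq_integrable[OF a] by simp
  show i: "integrable ?K \<phi>"
    by (rule Bochner_Integration.integrable_bound[OF i2 \<phi>]) (use ae c in \<open>auto elim!: eventually_mono\<close>)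
  have "\<bar>LINT w|?K. \<phi> w\<bar> \<le> (LINT w|?K. \<bar>\<phi> w\<bar>)"
    by (rule integral_abs_bound)
  also have "\<dots> \<le> (LINT w|?K. c * (real (fst w))\<^sup>2)"
    by (rule integral_mono_AE) (use i i2 ae in auto)
  also have "\<dots> \<le> c * B"
    using len_sq_mean_le[OF a] c by (simp add: mult_left_mono)
  finally show "\<bar>LINT w|?K. \<phi> w\<bar> \<le> c * B" .
qed

end

context bounded_run
begin

lemma starts_sets [measurable]: "starts n k t \<in> sets (pspace R)"
  by measurable

lemma len_sq_run_integrable:
  "integrable (pspace R) (\<lambda>\<omega>. indicator (starts n k t) \<omega> * (real (fst (frame_out R n k \<omega>)))\<^sup>2)"
proof (rule integrableI_nonneg)
  have "(\<integral>\<^sup>+\<omega>. ennreal (indicator (starts n k t) \<omega> * (real (fst (frame_out R n k \<omega>)))\<^sup>2) \<partial>pspace R)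
      = (\<integral>\<^sup>+\<omega>. indicator (space (pspace R) \<inter> starts n k t) \<omega> *
          ennreal ((real (fst (frame_out R n k \<omega>)))\<^sup>2) \<partial>pspace R)"
    by (intro nn_integral_cong) (auto simp: indicator_def)
  also have "\<dots> = (\<integral>\<^sup>+\<omega>. indicator (space (pspace R) \<inter> starts n k t) \<omega> *
      (\<integral>\<^sup>+w. ennreal ((real (fst w))\<^sup>2) \<partial>frame_law m n k (act R n k \<omega>)) \<partial>pspace R)"
    by (rule frame_out_nn_integral[where \<phi>="\<lambda>w. ennreal ((real (fst w))\<^sup>2)"])
      (use sets.top[of "past m R t"] in auto)
  also have "\<dots> \<le> (\<integral>\<^sup>+\<omega>. ennreal B \<partial>pspace R)"
  proof (intro nn_integral_mono)
    fix \<omega> assume \<omega>: "\<omega> \<in> space (pspace R)"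
    have "(\<integral>\<^sup>+w. ennreal ((real (fst w))\<^sup>2) \<partial>frame_law m n k (act R n k \<omega>)) \<le> ennreal B"
      using nn_integral_eq_integral[OF len_sq_integrable[OF act_in[OF \<omega>, of n k]], of k]
        len_sq_mean_le[OF act_in[OF \<omega>, of n k], of k]
      by (simp add: ennreal_leI)
    then show "indicator (space (pspace R) \<inter> starts n k t) \<omega> *
      (\<integral>\<^sup>+w. ennreal ((real (fst w))\<^sup>2) \<partial>frame_law m n k (act R n k \<omega>)) \<le> ennreal B"
      by (auto simp: indicator_def)
  qed
  also have "\<dots> < \<infinity>" by (simp add: P.emeasure_space_1)
  finally show "(\<integral>\<^sup>+\<omega>. ennreal (indicator (starts n k t) \<omega> * (real (fst (frame_out R n k \<omega>)))\<^sup>2) \<partial>pspace R) < \<infinity>" .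
qed auto

lemma frame_out_integrable:
  assumes q: "quadratic_on_frames n c \<phi>"
    and X: "X \<in> borel_measurable (pspace R)" "AE \<omega> in pspace R. \<bar>X \<omega>\<bar> \<le> x"
  shows "integrable (pspace R) (\<lambda>\<omega>. indicator (starts n k t) \<omega> * X \<omega> * \<phi> (frame_out R n k \<omega>))"
proof -
  have c: "0 \<le> c" and \<phi> [measurable]: "\<phi> \<in> borel_measurable frame_space"
    and ae: "\<And>a. a \<in> space (actions m n) \<Longrightarrow> AE w in frame_law m n k a. \<bar>\<phi> w\<bar> \<le> c * (real (fst w))\<^sup>2"
    using q unfolding quadratic_on_frames_def by blast+
  note X(1) [measurable]
  have *: "AE \<omega> in pspace R. \<bar>\<phi> (frame_out R n k \<omega>)\<bar> \<le> c * (real (fst (frame_out R n k \<omega>)))\<^sup>2"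
    by (rule AE_frame_out[OF _ ae]) measurable
  have i: "integrable (pspace R) (\<lambda>\<omega>. \<bar>x\<bar> * c * (indicator (starts n k t) \<omega> * (real (fst (frame_out R n k \<omega>)))\<^sup>2))"
    using len_sq_run_integrable by (rule integrable_mult_right)
  show ?thesis
  proof (rule Bochner_Integration.integrable_bound[OF i])
    show "(\<lambda>\<omega>. indicator (starts n k t) \<omega> * X \<omega> * \<phi> (frame_out R n k \<omega>)) \<in> borel_measurable (pspace R)"
      by measurable
    show "AE \<omega> in pspace R. norm (indicator (starts n k t) \<omega> * X \<omega> * \<phi> (frame_out R n k \<omega>))
        \<le> norm (\<bar>x\<bar> * c * (indicator (starts n k t) \<omega> * (real (fst (frame_out R n k \<omega>)))\<^sup>2))"
      using * X(2)
    proof eventually_elim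
      case (elim \<omega>)
      have "\<bar>X \<omega>\<bar> * \<bar>\<phi> (frame_out R n k \<omega>)\<bar> \<le> \<bar>x\<bar> * (c * (real (fst (frame_out R n k \<omega>)))\<^sup>2)"
        using elim by (intro mult_mono) auto
      then show ?case using c by (auto simp: indicator_def abs_mult mult.assoc)
    qed
  qed
qed

lemma mean_measurable:
  assumes "\<phi> \<in> borel_measurable frame_space"
  shows "(\<lambda>\<omega>. LINT w|frame_law m n k (act R n k \<omega>). (\<phi> w :: real)) \<in> borel_measurable (pspace R)"
  using measurable_compose[OF kernel_measurable integral_measurable_subprob_algebra[OF assms]] .

lemma mean_integrable:
  assumes q: "quadratic_on_frames n c \<phi>"
    and X: "X \<in> borel_measurable (pspace R)" "AE \<omega> in pspace R. \<bar>X \<omega>\<bar> \<le> x"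
  shows "integrable (pspace R) (\<lambda>\<omega>. indicator (starts n k t) \<omega> * X \<omega> *
    (LINT w|frame_law m n k (act R n k \<omega>). \<phi> w))" (is "integrable _ ?f")
proof (rule P.integrable_const_bound[where B="\<bar>x\<bar> * (c * B)"])
  have \<phi>: "\<phi> \<in> borel_measurable frame_space"
    using q unfolding quadratic_on_frames_def by blast
  show "?f \<in> borel_measurable (pspace R)"
    by (intro borel_measurable_times borel_measurable_indicator starts_sets X(1) mean_measurable \<phi>)
  show "AE \<omega> in pspace R. norm (?f \<omega>) \<le> \<bar>x\<bar> * (c * B)"
    using X(2) AE_space
  proof eventually_elim
    case (elim \<omega>)
    have "\<bar>X \<omega>\<bar> * \<bar>LINT w|frame_law m n k (act R n k \<omega>). \<phi> w\<bar> \<le> \<bar>x\<bar> * (c * B)"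
      using elim quadratic_integrable(2)[OF q act_in[OF elim(2), of n k], of k]
      by (intro mult_mono) auto
    moreover have "0 \<le> \<bar>x\<bar> * (c * B)"
      using q B_ge_1 unfolding quadratic_on_frames_def by simp
    ultimately show ?case by (auto simp: indicator_def abs_mult)
  qed
qed

lemma frame_out_integral_nonneg:
  assumes q: "quadratic_on_frames n c \<phi>" and nonneg: "\<And>w. 0 \<le> \<phi> w"
    and A: "A \<in> sets (past m R t)"
  shows "(LINT \<omega>:A|pspace R. indicator (starts n k t) \<omega> * \<phi> (frame_out R n k \<omega>)) =
    (LINT \<omega>:A|pspace R. indicator (starts n k t) \<omega> * (LINT w|frame_law m n k (act R n k \<omega>). \<phi> w))"
proof -
  have \<phi> [measurable]: "\<phi> \<in> borel_measurable frame_space"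
    using q unfolding quadratic_on_frames_def by blast
  note mean_measurable[OF \<phi>, measurable]
  have A' [measurable]: "A \<in> sets (pspace R)"
    using A past_subalgebra unfolding subalgebra_def by blast
  have eq: "(\<integral>\<^sup>+w. ennreal (\<phi> w) \<partial>frame_law m n k (act R n k \<omega>)) =
      ennreal (LINT w|frame_law m n k (act R n k \<omega>). \<phi> w)" if "\<omega> \<in> space (pspace R)" for \<omega>
    by (rule nn_integral_eq_integral) (use quadratic_integrable(1)[OF q act_in[OF that]] nonneg in auto)
  have mean_nonneg: "0 \<le> (LINT w|frame_law m n k (act R n k \<omega>). \<phi> w)" for \<omega>
    using nonneg by (intro integral_nonneg_AE) simp
  have "(LINT \<omega>:A|pspace R. indicator (starts n k t) \<omega> * \<phi> (frame_out R n k \<omega>)) =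
      enn2real (\<integral>\<^sup>+\<omega>. ennreal (indicator A \<omega> *\<^sub>R (indicator (starts n k t) \<omega> * \<phi> (frame_out R n k \<omega>))) \<partial>pspace R)"
    unfolding set_lebesgue_integral_def by (rule integral_eq_nn_integral) (use nonneg in auto)
  also have "(\<integral>\<^sup>+\<omega>. ennreal (indicator A \<omega> *\<^sub>R (indicator (starts n k t) \<omega> * \<phi> (frame_out R n k \<omega>))) \<partial>pspace R)
      = (\<integral>\<^sup>+\<omega>. indicator (A \<inter> starts n k t) \<omega> * ennreal (\<phi> (frame_out R n k \<omega>)) \<partial>pspace R)"
    by (intro nn_integral_cong) (auto simp: indicator_def)
  also have "\<dots> = (\<integral>\<^sup>+\<omega>. indicator (A \<inter> starts n k t) \<omega> *
      (\<integral>\<^sup>+w. ennreal (\<phi> w) \<partial>frame_law m n k (act R n k \<omega>)) \<partial>pspace R)"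
    by (rule frame_out_nn_integral[OF A]) measurable
  also have "\<dots> = (\<integral>\<^sup>+\<omega>. ennreal (indicator A \<omega> *\<^sub>R (indicator (starts n k t) \<omega> *
      (LINT w|frame_law m n k (act R n k \<omega>). \<phi> w))) \<partial>pspace R)"
    by (intro nn_integral_cong) (auto simp: indicator_def eq)
  also have "enn2real \<dots> = (LINT \<omega>:A|pspace R. indicator (starts n k t) \<omega> *
      (LINT w|frame_law m n k (act R n k \<omega>). \<phi> w))"
    unfolding set_lebesgue_integral_def
    by (rule integral_eq_nn_integral[symmetric]) (use mean_nonneg in auto)
  finally show ?thesis .
qed

text \<open>The mean of \<open>\<phi>\<close> under the frame law depends on the action, which may be randomized given the past; it
  replaces the outcome only under integrals over past events.\<close>

lemma frame_out_integral_set: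
  assumes q: "quadratic_on_frames n c \<phi>" and A: "A \<in> sets (past m R t)"
  shows "(LINT \<omega>:A|pspace R. indicator (starts n k t) \<omega> * \<phi> (frame_out R n k \<omega>)) =
    (LINT \<omega>:A|pspace R. indicator (starts n k t) \<omega> * (LINT w|frame_law m n k (act R n k \<omega>). \<phi> w))"
proof -
  let ?p = "\<lambda>w. max (\<phi> w) 0" and ?m = "\<lambda>w. max (- \<phi> w) 0"
  have \<phi> [measurable]: "\<phi> \<in> borel_measurable frame_space"
    using q unfolding quadratic_on_frames_def by blast
  have qp: "quadratic_on_frames n c ?p"
    using q unfolding quadratic_on_frames_def by (auto elim!: eventually_mono dest!: spec bspec)
  have qm: "quadratic_on_frames n c ?m"
    using q unfolding quadratic_on_frames_def by (auto elim!: eventually_mono dest!: spec bspec)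
  have A' [measurable]: "A \<in> sets (pspace R)"
    using A past_subalgebra unfolding subalgebra_def by blast
  have set: "set_integrable (pspace R) A f" if "integrable (pspace R) f" for f :: "'w \<Rightarrow> real"
    unfolding set_integrable_def using integrable_mult_indicator[OF A' that] .
  have i1: "set_integrable (pspace R) A (\<lambda>\<omega>. indicator (starts n k t) \<omega> * \<psi> (frame_out R n k \<omega>))"
    and i2: "set_integrable (pspace R) A (\<lambda>\<omega>. indicator (starts n k t) \<omega> *
      (LINT w|frame_law m n k (act R n k \<omega>). \<psi> w))" if "quadratic_on_frames n c \<psi>" for \<psi>
    using frame_out_integrable[OF that, of "\<lambda>_. 1" 1 k t] mean_integrable[OF that, of "\<lambda>_. 1" 1 k t]
    by (auto intro!: set)
  have "(LINT \<omega>:A|pspace R. indicator (starts n k t) \<omega> * \<phi> (frame_out R n k \<omega>)) =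
      (LINT \<omega>:A|pspace R. indicator (starts n k t) \<omega> * ?p (frame_out R n k \<omega>) -
        indicator (starts n k t) \<omega> * ?m (frame_out R n k \<omega>))"
    by (intro set_lebesgue_integral_cong) (auto simp: indicator_def max_def)
  also have "\<dots> = (LINT \<omega>:A|pspace R. indicator (starts n k t) \<omega> * ?p (frame_out R n k \<omega>)) -
      (LINT \<omega>:A|pspace R. indicator (starts n k t) \<omega> * ?m (frame_out R n k \<omega>))"
    by (rule set_integral_diff(2)[OF i1[OF qp] i1[OF qm]])
  also have "\<dots> = (LINT \<omega>:A|pspace R. indicator (starts n k t) \<omega> * (LINT w|frame_law m n k (act R n k \<omega>). ?p w)) -
      (LINT \<omega>:A|pspace R. indicator (starts n k t) \<omega> * (LINT w|frame_law m n k (act R n k \<omega>). ?m w))"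
    using frame_out_integral_nonneg[OF qp _ A, of k] frame_out_integral_nonneg[OF qm _ A, of k] by simp
  also have "\<dots> = (LINT \<omega>:A|pspace R. indicator (starts n k t) \<omega> * (LINT w|frame_law m n k (act R n k \<omega>). ?p w) -
      indicator (starts n k t) \<omega> * (LINT w|frame_law m n k (act R n k \<omega>). ?m w))"
    by (rule set_integral_diff(2)[OF i2[OF qp] i2[OF qm], symmetric])
  also have "\<dots> = (LINT \<omega>:A|pspace R. indicator (starts n k t) \<omega> * (LINT w|frame_law m n k (act R n k \<omega>). \<phi> w))"
  proof (intro set_lebesgue_integral_cong ballI allI impI)
    fix \<omega> assume "\<omega> \<in> A"
    then have \<omega>: "\<omega> \<in> space (pspace R)" using A' sets.sets_into_space by blast
    have "(LINT w|frame_law m n k (act R n k \<omega>). \<phi> w) = (LINT w|frame_law m n k (act R n k \<omega>). ?p w - ?m w)"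
      by (intro Bochner_Integration.integral_cong) auto
    also have "\<dots> = (LINT w|frame_law m n k (act R n k \<omega>). ?p w) - (LINT w|frame_law m n k (act R n k \<omega>). ?m w)"
      by (rule Bochner_Integration.integral_diff) (rule quadratic_integrable(1)[OF qp act_in[OF \<omega>]] quadratic_integrable(1)[OF qm act_in[OF \<omega>]])+
    finally show "indicator (starts n k t) \<omega> * (LINT w|frame_law m n k (act R n k \<omega>). ?p w) -
      indicator (starts n k t) \<omega> * (LINT w|frame_law m n k (act R n k \<omega>). ?m w) =
      indicator (starts n k t) \<omega> * (LINT w|frame_law m n k (act R n k \<omega>). \<phi> w)"
      by (simp add: right_diff_distrib)
  qed (rule A')
  finally show ?thesis .
qed

text \<open>Both functions have the same integral over every past event, hence the same conditional
  expectation given the past, and \<open>X\<close> may be pulled out of either.\<close>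

lemma frame_out_integral:
  assumes q: "quadratic_on_frames n c \<phi>"
    and X: "X \<in> borel_measurable (past m R t)" "AE \<omega> in pspace R. \<bar>X \<omega>\<bar> \<le> x"
  shows "(LINT \<omega>|pspace R. indicator (starts n k t) \<omega> * X \<omega> * \<phi> (frame_out R n k \<omega>)) =
    (LINT \<omega>|pspace R. indicator (starts n k t) \<omega> * X \<omega> * (LINT w|frame_law m n k (act R n k \<omega>). \<phi> w))"
proof -
  let ?f = "\<lambda>\<omega>. indicator (starts n k t) \<omega> * \<phi> (frame_out R n k \<omega>)"
  let ?g = "\<lambda>\<omega>. indicator (starts n k t) \<omega> * (LINT w|frame_law m n k (act R n k \<omega>). \<phi> w)"
  interpret F: sigma_finite_subalgebra "pspace R" "past m R t"
    by (rule finite_measure_subalgebra_is_sigma_finite)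
      (simp add: finite_measure_subalgebra_def finite_measure_subalgebra_axioms_def
        past_subalgebra P.finite_measure_axioms)
  have if': "integrable (pspace R) ?f" and ig: "integrable (pspace R) ?g"
    using frame_out_integrable[OF q, of "\<lambda>_. 1" 1 k t] mean_integrable[OF q, of "\<lambda>_. 1" 1 k t] by auto
  have ae: "AE \<omega> in pspace R. real_cond_exp (pspace R) (past m R t) ?f \<omega> = real_cond_exp (pspace R) (past m R t) ?g \<omega>"
  proof (rule F.real_cond_exp_charact)
    fix A assume A: "A \<in> sets (past m R t)"
    show "(LINT \<omega>:A|pspace R. ?f \<omega>) = (LINT \<omega>:A|pspace R. real_cond_exp (pspace R) (past m R t) ?g \<omega>)"
      using frame_out_integral_set[OF q A] F.real_cond_exp_intA[OF ig A] by simp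
  qed (use if' F.real_cond_exp_int(1)[OF ig] in auto)
  have i: "integrable (pspace R) (\<lambda>\<omega>. X \<omega> * ?f \<omega>)" "integrable (pspace R) (\<lambda>\<omega>. X \<omega> * ?g \<omega>)"
    using frame_out_integrable[OF q past_measurable[OF X(1)] X(2), of k t]
      mean_integrable[OF q past_measurable[OF X(1)] X(2), of k t]
    by (simp_all add: mult_ac)
  have "(LINT \<omega>|pspace R. X \<omega> * ?f \<omega>) = (LINT \<omega>|pspace R. X \<omega> * real_cond_exp (pspace R) (past m R t) ?f \<omega>)"
    by (rule F.real_cond_exp_intg(2)[OF i(1) X(1), symmetric]) (use if' in auto)
  also have "\<dots> = (LINT \<omega>|pspace R. X \<omega> * real_cond_exp (pspace R) (past m R t) ?g \<omega>)"
    by (rule integral_cong_AE)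
      (use ae past_measurable[OF X(1)] in \<open>auto intro!: borel_measurable_times borel_measurable_cond_exp2 elim!: eventually_mono\<close>)
  also have "\<dots> = (LINT \<omega>|pspace R. X \<omega> * ?g \<omega>)"
    by (rule F.real_cond_exp_intg(2)[OF i(2) X(1)]) (use ig in auto)
  finally show ?thesis by (simp add: mult_ac)
qed

end

section \<open>Slots and frames\<close>

lemma sum_over_frames_upto:
  fixes x :: "nat \<Rightarrow> real"
  assumes "strict_mono \<tau>" and "\<tau> 0 = (0::nat)"
  shows "(\<Sum>t<\<tau> K. x t) = (\<Sum>k<K. \<Sum>i<\<tau> (Suc k) - \<tau> k. x (\<tau> k + i))"
proof (induction K)
  case 0
  then show ?case using assms(2) by simp
next
  case (Suc K)
  have le: "\<tau> K \<le> \<tau> (Suc K)" using strict_mono_leD[OF assms(1)] by simp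
  have "(\<Sum>t<\<tau> (Suc K). x t) = (\<Sum>t<\<tau> K. x t) + (\<Sum>t=\<tau> K..<\<tau> (Suc K). x t)"
    using sum.atLeastLessThan_concat[of 0 "\<tau> K" "\<tau> (Suc K)" x] le by (simp add: atLeast0LessThan)
  also have "(\<Sum>t=\<tau> K..<\<tau> (Suc K). x t) = (\<Sum>i<\<tau> (Suc K) - \<tau> K. x (\<tau> K + i))"
    using sum.shift_bounds_nat_ivl[of x 0 "\<tau> K" "\<tau> (Suc K) - \<tau> K"] le
    by (simp add: atLeast0LessThan add.commute)
  finally show ?case using Suc by simp
qed

lemma sum_over_frames:
  fixes x :: "nat \<Rightarrow> real"
  assumes "strict_mono \<tau>" and "\<tau> 0 = (0::nat)"
  shows "(\<Sum>t<T. x t) = (\<Sum>k<T. \<Sum>i<\<tau> (Suc k) - \<tau> k. if \<tau> k + i < T then x (\<tau> k + i) else 0)"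
proof -
  have "(\<Sum>t<T. x t) = (\<Sum>t<\<tau> T. if t < T then x t else 0)"
    using strict_mono_imp_increasing[OF assms(1), of T]
    by (intro sum.mono_neutral_cong_left) auto
  then show ?thesis
    using sum_over_frames_upto[OF assms, of "\<lambda>t. if t < T then x t else 0" T] by simp
qed

text \<open>Read \<open>x t\<close> as the reward of slot \<open>t\<close> and \<open>r s t\<close> as its reward when the weights are those of the
  slot \<open>s\<close> where its frame started.  The frame in progress at \<open>T\<close> is completed at a cost of at most
  \<open>c\<close> per additional slot, and the ages of the slots of a frame of length \<open>L\<close> sum up to at most \<open>L\<^sup>2\<close>.
  The frames are indexed by \<open>k < T\<close>, because every frame has at least one slot.\<close>

lemma sum_slots_le_sum_whole_frames:
  fixes x :: "nat \<Rightarrow> real" and r :: "nat \<Rightarrow> nat \<Rightarrow> real"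
  assumes \<tau>: "strict_mono \<tau>" "\<tau> 0 = (0::nat)"
    and r: "\<And>s t. s < T \<Longrightarrow> \<bar>r s t\<bar> \<le> c"
    and x: "\<And>s i. s + i < T \<Longrightarrow> x (s + i) \<le> r s (s + i) + \<rho> * real i"
    and \<rho>: "0 \<le> \<rho>"
  shows "(\<Sum>t<T. x t) \<le> (\<Sum>k<T. \<Sum>s<T. of_bool (\<tau> k = s) *
    ((\<Sum>i<\<tau> (Suc k) - \<tau> k. r s (s + i)) + c * max (real (\<tau> (Suc k) - \<tau> k) - real (T - s)) 0
      + \<rho> * (real (\<tau> (Suc k) - \<tau> k))\<^sup>2))"
  unfolding sum_over_frames[OF \<tau>, of x]
proof (rule sum_mono)
  fix k
  define len where "len = \<tau> (Suc k) - \<tau> k"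
  let ?E = "\<lambda>s. (\<Sum>i<len. r s (s + i)) + c * max (real len - real (T - s)) 0 + \<rho> * (real len)\<^sup>2"
  have "(\<Sum>i<len. if \<tau> k + i < T then x (\<tau> k + i) else 0) \<le> (\<Sum>s<T. of_bool (\<tau> k = s) * ?E s)"
  proof (cases "\<tau> k < T")
    case False
    then have "(\<Sum>s<T. of_bool (\<tau> k = s) * ?E s) = 0" by (intro sum.neutral) auto
    with False show ?thesis by simp
  next
    case True
    then have c: "0 \<le> c" using r[of "\<tau> k" 0] by linarith
    have "(\<Sum>i<len. if \<tau> k + i < T then x (\<tau> k + i) else 0)
        \<le> (\<Sum>i<len. r (\<tau> k) (\<tau> k + i) + c * of_bool (T - \<tau> k \<le> i) + \<rho> * real len)"
    proof (rule sum_mono)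
      fix i assume "i \<in> {..<len}"
      then have "\<rho> * real i \<le> \<rho> * real len" "0 \<le> \<rho> * real len" using \<rho> by (auto intro: mult_left_mono)
      then show "(if \<tau> k + i < T then x (\<tau> k + i) else 0)
          \<le> r (\<tau> k) (\<tau> k + i) + c * of_bool (T - \<tau> k \<le> i) + \<rho> * real len"
        using x[of "\<tau> k" i] r[OF True, of "\<tau> k + i"] c by (auto simp: of_bool_def)
    qed
    also have "\<dots> = (\<Sum>i<len. r (\<tau> k) (\<tau> k + i)) + c * (\<Sum>i<len. of_bool (T - \<tau> k \<le> i)) + \<rho> * (real len)\<^sup>2"
      by (simp add: sum.distrib sum_distrib_left power2_eq_square)
    also have "(\<Sum>i<len. of_bool (T - \<tau> k \<le> i)) = (\<Sum>i\<in>{T - \<tau> k..<len}. 1 :: real)"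
      by (intro sum.mono_neutral_cong_right) auto
    also have "\<dots> = max (real len - real (T - \<tau> k)) 0"
      by (simp add: max_def of_nat_diff)
    also have "(\<Sum>i<len. r (\<tau> k) (\<tau> k + i)) + c * max (real len - real (T - \<tau> k)) 0 + \<rho> * (real len)\<^sup>2
        = (\<Sum>s\<in>{\<tau> k}. of_bool (\<tau> k = s) * ?E s)"
      by simp
    also have "\<dots> = (\<Sum>s<T. of_bool (\<tau> k = s) * ?E s)"
      by (rule sum.mono_neutral_left) (use True in auto)
    finally show ?thesis .
  qed
  then show "(\<Sum>i<\<tau> (Suc k) - \<tau> k. if \<tau> k + i < T then x (\<tau> k + i) else 0) \<le>
    (\<Sum>s<T. of_bool (\<tau> k = s) *
      ((\<Sum>i<\<tau> (Suc k) - \<tau> k. r s (s + i)) + c * max (real (\<tau> (Suc k) - \<tau> k) - real (T - s)) 0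
        + \<rho> * (real (\<tau> (Suc k) - \<tau> k))\<^sup>2))"
    by (simp add: len_def)
qed

text \<open>Weak inequality at the end of the frame matches the event in the residual bound; the frame is
  still unique, since a frame that ends at \<open>T\<close> is followed by one that starts at \<open>T\<close>.\<close>

lemma one_frame_straddles:
  assumes \<tau>: "strict_mono (\<tau> :: nat \<Rightarrow> nat)"
  shows "(\<Sum>k<K. \<Sum>s<T. of_bool (\<tau> k = s) * of_bool (T - s \<le> \<tau> (Suc k) - \<tau> k)) \<le> (1::real)"
proof -
  have "(\<Sum>k<K. \<Sum>s<T. of_bool (\<tau> k = s) * of_bool (T - s \<le> \<tau> (Suc k) - \<tau> k))
      = (\<Sum>k<K. of_bool (\<tau> k < T \<and> T \<le> \<tau> (Suc k)) :: real)"
  proof (rule sum.cong[OF refl])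
    fix k
    have "\<tau> k \<le> \<tau> (Suc k)" using strict_mono_leD[OF \<tau>] by simp
    show "(\<Sum>s<T. of_bool (\<tau> k = s) * of_bool (T - s \<le> \<tau> (Suc k) - \<tau> k))
      = (of_bool (\<tau> k < T \<and> T \<le> \<tau> (Suc k)) :: real)"
    proof (cases "\<tau> k < T")
      case True
      have "(\<Sum>s<T. of_bool (\<tau> k = s) * of_bool (T - s \<le> \<tau> (Suc k) - \<tau> k))
        = (\<Sum>s\<in>{\<tau> k}. of_bool (\<tau> k = s) * of_bool (T - s \<le> \<tau> (Suc k) - \<tau> k) :: real)"
        by (rule sum.mono_neutral_right) (use True in auto)
      then show ?thesis using True \<open>\<tau> k \<le> \<tau> (Suc k)\<close> by (auto simp: of_bool_def)
    qed (auto intro!: sum.neutral)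
  qed
  also have "\<dots> = real (card {k\<in>{..<K}. \<tau> k < T \<and> T \<le> \<tau> (Suc k)})"
    by (simp add: of_bool_def sum.If_cases Int_def conj_commute)
  also have "\<dots> \<le> 1"
  proof -
    have "j = k" if "\<tau> j < T" "T \<le> \<tau> (Suc j)" "\<tau> k < T" "T \<le> \<tau> (Suc k)" for j k
    proof (rule ccontr)
      assume "j \<noteq> k"
      then have "Suc j \<le> k \<or> Suc k \<le> j" by auto
      then have "\<tau> (Suc j) \<le> \<tau> k \<or> \<tau> (Suc k) \<le> \<tau> j" using strict_mono_leD[OF \<tau>] by blast
      then show False using that by auto
    qed
    then have "card {k\<in>{..<K}. \<tau> k < T \<and> T \<le> \<tau> (Suc k)} \<le> Suc 0"
      by (subst card_le_Suc0_iff_eq) auto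
    then show ?thesis by simp
  qed
  finally show ?thesis .
qed

lemma frame_containing:
  assumes \<tau>: "strict_mono (\<tau> :: nat \<Rightarrow> nat)" and "\<tau> 0 = 0"
  obtains k where "\<tau> k \<le> t" "t < \<tau> (Suc k)"
proof -
  have "t < \<tau> (Suc t)" using strict_mono_imp_increasing[OF \<tau>, of "Suc t"] by simp
  then have ex: "\<exists>j. t < \<tau> j" by blast
  define j where "j = (LEAST j. t < \<tau> j)"
  have j: "t < \<tau> j" unfolding j_def using ex by (rule LeastI_ex)
  with assms(2) have "j \<noteq> 0" by (metis not_less_zero)
  then obtain k where k: "j = Suc k" by (cases j) auto
  have "\<not> t < \<tau> k" using not_less_Least[of k "\<lambda>j. t < \<tau> j"] k unfolding j_def by simp
  with j k show ?thesis by (intro that[of k]) auto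
qed

context bounded_renewal
begin

lemma quadratic_of_linear:
  assumes "0 \<le> c" "\<phi> \<in> borel_measurable frame_space"
    and "\<And>k a. a \<in> space (actions m n) \<Longrightarrow> AE w in frame_law m n k a. \<bar>\<phi> w\<bar> \<le> c * real (fst w)"
  shows "quadratic_on_frames n c \<phi>"
  unfolding quadratic_on_frames_def
proof (intro conjI assms(1,2) allI ballI)
  fix k a assume "a \<in> space (actions m n)"
  from assms(3)[OF this] show "AE w in frame_law m n k a. \<bar>\<phi> w\<bar> \<le> c * (real (fst w))\<^sup>2"
  proof eventually_elim
    case (elim w)
    have "real (fst w) \<le> (real (fst w))\<^sup>2" by (cases "fst w") (auto simp: power2_eq_square)
    with elim assms(1) show ?case by (meson mult_left_mono order_trans)
  qed
qed

lemma AE_pen_sum_le: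
  assumes "a \<in> space (actions m n)"
  shows "AE w in frame_law m n k a. \<bar>pen_sum w\<bar> \<le> Y * real (fst w)"
  using frame_bounds[OF assms]
proof eventually_elim
  case (elim w)
  then have "\<bar>pen_sum w\<bar> \<le> (\<Sum>i<fst w. Y)"
    unfolding pen_sum_def by (intro order_trans[OF sum_abs] sum_mono) auto
  then show ?case by (simp add: mult.commute)
qed

lemma AE_met_sum_le:
  assumes "a \<in> space (actions m n)"
  shows "AE w in frame_law m n k a. \<bar>met_sum l w\<bar> \<le> Z * real (fst w)"
  using frame_bounds[OF assms]
proof eventually_elim
  case (elim w)
  then have "\<bar>met_sum l w\<bar> \<le> (\<Sum>i<fst w. Z)"
    unfolding met_sum_def by (intro order_trans[OF sum_abs] sum_mono) auto
  then show ?case by (simp add: mult.commute)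
qed

lemma quadratic_pen_sum: "quadratic_on_frames n Y pen_sum"
  by (rule quadratic_of_linear[OF Y_nonneg sum_measurable(1) AE_pen_sum_le])

lemma quadratic_met_sum: "quadratic_on_frames n Z (met_sum l)"
  by (rule quadratic_of_linear[OF Z_nonneg sum_measurable(2) AE_met_sum_le])

lemma quadratic_len: "quadratic_on_frames n 1 (\<lambda>w. real (fst w))"
  by (rule quadratic_of_linear) auto

lemma quadratic_residual: "quadratic_on_frames n 1 (\<lambda>w. max (real (fst w) - real s) 0)"
  by (rule quadratic_of_linear) auto

lemma quadratic_len_sq: "quadratic_on_frames n 1 (\<lambda>w. (real (fst w))\<^sup>2)"
  unfolding quadratic_on_frames_def by auto

lemma quadratic_tail: "quadratic_on_frames n 1 (indicator {w. s \<le> fst w})"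
proof (rule quadratic_of_linear)
  have "{w \<in> space frame_space. s \<le> fst w} \<in> sets (frame_space :: 'l frame measure)" by measurable
  then show "indicator {w. s \<le> fst w} \<in> borel_measurable (frame_space :: 'l frame measure)"
    by (intro borel_measurable_indicator) simp
  fix k a assume "a \<in> space (actions m n)"
  from AE_len_ge_1[OF this] show "AE w in frame_law m n k a. \<bar>indicator {w. s \<le> fst w} w\<bar> \<le> 1 * real (fst w)"
    by eventually_elim (auto simp: indicator_def)
qed simp

lemma mean_eqs:
  assumes "a \<in> space (actions m n)"
  shows "(LINT w|frame_law m n k a. pen_sum w) = yhat m n a"
    and "(LINT w|frame_law m n k a. met_sum l w) = zhat m n a $ l"
    and "(LINT w|frame_law m n k a. real (fst w)) = That m n a"
proof -
  have "mean_len m n k a = mean_len m n 0 a" "mean_pen m n k a = mean_pen m n 0 a"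
    "mean_met m n k a $ l = mean_met m n 0 a $ l"
    using model[unfolded renewal_model_def, THEN conjunct2, THEN conjunct2, THEN conjunct1,
        rule_format, OF assms, of k] by simp_all
  then show "(LINT w|frame_law m n k a. pen_sum w) = yhat m n a"
    and "(LINT w|frame_law m n k a. met_sum l w) = zhat m n a $ l"
    and "(LINT w|frame_law m n k a. real (fst w)) = That m n a"
    by (simp_all add: mean_len_def mean_pen_def mean_met_def pen_sum_def met_sum_def case_prod_beta')
qed

end

section \<open>The renewal-reward inequality\<close>

lemma abs_inner_le:
  fixes u v :: "real^'l::finite"
  assumes "\<And>l. \<bar>v $ l\<bar> \<le> b"
  shows "\<bar>u \<bullet> v\<bar> \<le> (\<Sum>l\<in>UNIV. \<bar>u $ l\<bar>) * b"
proof -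
  have "\<bar>u \<bullet> v\<bar> \<le> (\<Sum>l\<in>UNIV. \<bar>u $ l * v $ l\<bar>)"
    unfolding inner_vec_def by (simp add: sum_abs)
  also have "\<dots> \<le> (\<Sum>l\<in>UNIV. \<bar>u $ l\<bar> * b)"
    by (intro sum_mono) (simp add: abs_mult mult_left_mono assms)
  finally show ?thesis by (simp add: sum_distrib_right)
qed

context bounded_run
begin

text \<open>Every slot lies in some frame, so the bounds on frames become bounds on slots.\<close>

lemma AE_pen_met_bounds:
  "AE \<omega> in pspace R. \<forall>n t. \<bar>pen R n t \<omega>\<bar> \<le> Y \<and> (\<forall>l. \<bar>met R n t \<omega> $ l\<bar> \<le> Z)"
proof -
  let ?Q = "\<lambda>w :: 'l frame. \<forall>i<fst w. \<bar>fst (snd w) i\<bar> \<le> Y \<and> (\<forall>l. \<bar>snd (snd w) i $ l\<bar> \<le> Z)"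
  have [measurable]: "?Q \<in> frame_space \<rightarrow>\<^sub>M count_space UNIV"
  proof -
    have "(\<lambda>w :: 'l frame. \<forall>i. i < fst w \<longrightarrow>
        \<bar>fst (snd w) i\<bar> \<le> Y \<and> (\<forall>l\<in>UNIV. \<bar>snd (snd w) i $ l\<bar> \<le> Z)) \<in> frame_space \<rightarrow>\<^sub>M count_space UNIV"
      by measurable
    then show ?thesis by simp
  qed
  have Q: "AE \<omega> in pspace R. ?Q (frame_out R n k \<omega>)" for n k
    by (rule AE_frame_out) (use frame_bounds in auto)
  have "AE \<omega> in pspace R. \<forall>n k. ?Q (frame_out R n k \<omega>)"
    by (rule AE_all_countable[THEN iffD2], rule allI, rule AE_all_countable[THEN iffD2], rule allI, rule Q)
  with AE_space show ?thesis
  proof eventually_elim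
    case (elim \<omega>)
    show ?case
    proof (intro allI)
      fix n t
      obtain k where k: "rtime R n k \<omega> \<le> t" "t < rtime R n (Suc k) \<omega>"
        using frame_containing[OF rtime_strict_mono[OF elim(1)] rtime_0[OF elim(1)]] by blast
      define i where "i = t - rtime R n k \<omega>"
      have t: "t = rtime R n k \<omega> + i" and i: "i < frame_len R n k \<omega>"
        using k by (auto simp: i_def frame_len_def)
      show "\<bar>pen R n t \<omega>\<bar> \<le> Y \<and> (\<forall>l. \<bar>met R n t \<omega> $ l\<bar> \<le> Z)"
        using elim(2)[rule_format, of i n k] i by (simp add: frame_out_def t)
    qed
  qed
qed

lemma ext_distr: "distr (pspace R) borel (ext R t) = ext_law m"
  using run unfolding renewal_run_def external_iid_def by blast

lemma AE_ext_bound: "AE \<omega> in pspace R. \<forall>t l. \<bar>ext R t \<omega> $ l\<bar> \<le> D"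
proof -
  have "AE \<omega> in pspace R. \<forall>l. \<bar>ext R t \<omega> $ l\<bar> \<le> D" for t
    by (rule AE_distrD[of "ext R t" "pspace R" borel], measurable, unfold ext_distr, rule ext_bound)
  then show ?thesis by (rule AE_all_countable[THEN iffD2, OF allI])
qed

lemma AE_bounded_integrable:
  fixes f :: "'w \<Rightarrow> real"
  assumes "f \<in> borel_measurable (pspace R)" "AE \<omega> in pspace R. \<bar>f \<omega>\<bar> \<le> b"
  shows "integrable (pspace R) f"
  by (rule P.integrable_const_bound[of f b]) (use assms in auto)

lemma pen_integrable: "integrable (pspace R) (pen R n t)"
  by (rule AE_bounded_integrable[of _ Y]) (use AE_pen_met_bounds in \<open>auto elim!: eventually_mono\<close>)

lemma met_integrable: "integrable (pspace R) (\<lambda>\<omega>. met R n t \<omega> $ l)"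
  by (rule AE_bounded_integrable[of _ Z]) (use AE_pen_met_bounds in \<open>auto elim!: eventually_mono\<close>)

lemma ext_integrable: "integrable (pspace R) (\<lambda>\<omega>. ext R t \<omega> $ l)"
  by (rule AE_bounded_integrable[of _ D]) (use AE_ext_bound in \<open>auto elim!: eventually_mono\<close>)

lemma starts_disjoint_sum: "(\<Sum>t<T. measure (pspace R) (starts n k t)) \<le> 1"
proof -
  have "(\<Sum>t<T. measure (pspace R) (starts n k t)) = measure (pspace R) (\<Union>t<T. starts n k t)"
    by (rule P.finite_measure_finite_Union[symmetric]) (auto simp: disjoint_family_on_def)
  then show ?thesis by simp
qed

text \<open>Replacing the outcome of the frame by its conditional means turns the weighted penalty and metric
  sums into the left-hand side of assumption \<open>le\<close>, which \<open>\<theta>\<close> times the mean length dominates.  Only the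
  two error terms remain; the overshoot keeps the probability that the frame reaches length \<open>s\<close>.\<close>

lemma whole_frame_bound:
  fixes V c \<rho> \<theta>' :: real and s :: nat
  assumes W: "\<And>l. (\<lambda>\<omega>. W \<omega> $ l) \<in> borel_measurable (past m R t)" "\<And>l. AE \<omega> in pspace R. \<bar>W \<omega> $ l\<bar> \<le> w"
    and \<theta>: "\<theta> \<in> borel_measurable (past m R t)" "AE \<omega> in pspace R. \<bar>\<theta> \<omega>\<bar> \<le> \<theta>'"
    and le: "AE \<omega> in pspace R. rtime R n k \<omega> = t \<longrightarrow>
      V * yhat m n (act R n k \<omega>) + W \<omega> \<bullet> zhat m n (act R n k \<omega>) \<le> \<theta> \<omega> * That m n (act R n k \<omega>)"
    and c: "0 \<le> c" and \<rho>: "0 \<le> \<rho>"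
  defines "X \<equiv> \<lambda>\<omega>. indicator (starts n k t) \<omega> *
      (V * pen_sum (frame_out R n k \<omega>) + (\<Sum>l\<in>UNIV. W \<omega> $ l * met_sum l (frame_out R n k \<omega>))
        - \<theta> \<omega> * real (frame_len R n k \<omega>) + c * max (real (frame_len R n k \<omega>) - real s) 0
        + \<rho> * (real (frame_len R n k \<omega>))\<^sup>2)"
  shows "integrable (pspace R) X"
    and "(LINT \<omega>|pspace R. X \<omega>) \<le>
      c * B * measure (pspace R) {\<omega> \<in> starts n k t. s \<le> frame_len R n k \<omega>}
      + \<rho> * B * measure (pspace R) (starts n k t)"
proof -
  let ?I = "indicator (starts n k t) :: 'w \<Rightarrow> real"
  let ?o = "frame_out R n k"
  let ?M = "\<lambda>\<phi> \<omega>. LINT w|frame_law m n k (act R n k \<omega>). \<phi> w"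
  let ?res = "\<lambda>w :: 'l frame. max (real (fst w) - real s) 0"
  let ?sq = "\<lambda>w :: 'l frame. (real (fst w))\<^sup>2"
  let ?len = "\<lambda>w :: 'l frame. real (fst w)"
  let ?tail = "indicator {w :: 'l frame. s \<le> fst w} :: 'l frame \<Rightarrow> real"
  have fst_o: "fst (?o \<omega>) = frame_len R n k \<omega>" for \<omega> by (simp add: frame_out_def)
  have const: "(\<lambda>_. a) \<in> borel_measurable (past m R t)" "AE \<omega> in pspace R. \<bar>a\<bar> \<le> \<bar>a\<bar>" for a :: real
    by auto
  have transfer: "integrable (pspace R) (\<lambda>\<omega>. ?I \<omega> * U \<omega> * \<phi> (?o \<omega>))"
    "integrable (pspace R) (\<lambda>\<omega>. ?I \<omega> * U \<omega> * ?M \<phi> \<omega>)"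
    "(LINT \<omega>|pspace R. ?I \<omega> * U \<omega> * \<phi> (?o \<omega>)) = (LINT \<omega>|pspace R. ?I \<omega> * U \<omega> * ?M \<phi> \<omega>)"
    if "quadratic_on_frames n q \<phi>" "U \<in> borel_measurable (past m R t)" "AE \<omega> in pspace R. \<bar>U \<omega>\<bar> \<le> u"
    for q \<phi> U u
    using frame_out_integrable[OF that(1) past_measurable[OF that(2)] that(3)]
      mean_integrable[OF that(1) past_measurable[OF that(2)] that(3)]
      frame_out_integral[OF that] by auto
  note tp = transfer[OF quadratic_pen_sum const]
  note tm = transfer[OF quadratic_met_sum W]
  note tl = transfer[OF quadratic_len \<theta>]
  note tr = transfer[OF quadratic_residual const]
  note ts = transfer[OF quadratic_len_sq const]
  note tt = transfer[OF quadratic_tail const]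
  have X: "X = (\<lambda>\<omega>. ?I \<omega> * V * pen_sum (?o \<omega>) + (\<Sum>l\<in>UNIV. ?I \<omega> * W \<omega> $ l * met_sum l (?o \<omega>))
      - ?I \<omega> * \<theta> \<omega> * ?len (?o \<omega>) + ?I \<omega> * c * ?res (?o \<omega>) + ?I \<omega> * \<rho> * ?sq (?o \<omega>))"
    unfolding X_def fst_o by (auto simp: fun_eq_iff split: split_indicator)
  show "integrable (pspace R) X"
    unfolding X by (intro Bochner_Integration.integrable_add Bochner_Integration.integrable_diff
        Bochner_Integration.integrable_sum tp(1) tm(1) tl(1) tr(1) ts(1))
  have "(LINT \<omega>|pspace R. X \<omega>) = (LINT \<omega>|pspace R. ?I \<omega> * V * ?M pen_sum \<omega>)
      + (\<Sum>l\<in>UNIV. LINT \<omega>|pspace R. ?I \<omega> * W \<omega> $ l * ?M (met_sum l) \<omega>)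
      - (LINT \<omega>|pspace R. ?I \<omega> * \<theta> \<omega> * ?M ?len \<omega>) + (LINT \<omega>|pspace R. ?I \<omega> * c * ?M ?res \<omega>)
      + (LINT \<omega>|pspace R. ?I \<omega> * \<rho> * ?M ?sq \<omega>)"
    unfolding X
    by (simp only: Bochner_Integration.integral_add Bochner_Integration.integral_diff
        Bochner_Integration.integral_sum Bochner_Integration.integrable_add Bochner_Integration.integrable_diff
        Bochner_Integration.integrable_sum tp tm tl tr ts)
  also have "\<dots> = (LINT \<omega>|pspace R. ?I \<omega> * V * ?M pen_sum \<omega>
      + (\<Sum>l\<in>UNIV. ?I \<omega> * W \<omega> $ l * ?M (met_sum l) \<omega>)
      - ?I \<omega> * \<theta> \<omega> * ?M ?len \<omega> + ?I \<omega> * c * ?M ?res \<omega>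
      + ?I \<omega> * \<rho> * ?M ?sq \<omega>)"
    by (simp only: Bochner_Integration.integral_add Bochner_Integration.integral_diff
        Bochner_Integration.integral_sum Bochner_Integration.integrable_add Bochner_Integration.integrable_diff
        Bochner_Integration.integrable_sum tp tm tl tr ts)
  also have "\<dots> \<le> (LINT \<omega>|pspace R. ?I \<omega> * (c * B) * ?M ?tail \<omega> + ?I \<omega> * (\<rho> * B) * 1)"
  proof (rule integral_mono_AE)
    show "integrable (pspace R) (\<lambda>\<omega>. ?I \<omega> * V * ?M pen_sum \<omega>
      + (\<Sum>l\<in>UNIV. ?I \<omega> * W \<omega> $ l * ?M (met_sum l) \<omega>)
      - ?I \<omega> * \<theta> \<omega> * ?M ?len \<omega> + ?I \<omega> * c * ?M ?res \<omega>
      + ?I \<omega> * \<rho> * ?M ?sq \<omega>)"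
      by (intro Bochner_Integration.integrable_add Bochner_Integration.integrable_diff
        Bochner_Integration.integrable_sum tp(2) tm(2) tl(2) tr(2) ts(2))
    have "integrable (pspace R) (\<lambda>\<omega>. ?I \<omega> * (\<rho> * B) * 1)"
      by (simp add: P.emeasure_eq_measure)
    then show "integrable (pspace R) (\<lambda>\<omega>. ?I \<omega> * (c * B) * ?M ?tail \<omega> + ?I \<omega> * (\<rho> * B) * 1)"
      by (intro Bochner_Integration.integrable_add tt(2))
    show "AE \<omega> in pspace R. ?I \<omega> * V * ?M pen_sum \<omega>
      + (\<Sum>l\<in>UNIV. ?I \<omega> * W \<omega> $ l * ?M (met_sum l) \<omega>)
      - ?I \<omega> * \<theta> \<omega> * ?M ?len \<omega> + ?I \<omega> * c * ?M ?res \<omega>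
      + ?I \<omega> * \<rho> * ?M ?sq \<omega> \<le> ?I \<omega> * (c * B) * ?M ?tail \<omega> + ?I \<omega> * (\<rho> * B) * 1"
      using le AE_space
    proof eventually_elim
      case (elim \<omega>)
      show ?case
      proof (cases "rtime R n k \<omega> = t")
        case True
        note a = act_in[OF elim(2), of n k]
        have tail: "?M ?tail \<omega> = measure (frame_law m n k (act R n k \<omega>)) {w. s \<le> fst w}"
          using len_ge_sets[OF a] by simp
        have "c * ?M ?res \<omega> \<le> c * (B * ?M ?tail \<omega>)"
          unfolding tail by (rule mult_left_mono[OF residual_mean_le[OF a] c])
        moreover have "\<rho> * ?M ?sq \<omega> \<le> \<rho> * B"
          by (rule mult_left_mono[OF len_sq_mean_le[OF a] \<rho>])
        moreover have "V * ?M pen_sum \<omega> + (\<Sum>l\<in>UNIV. W \<omega> $ l * ?M (met_sum l) \<omega>) - \<theta> \<omega> * ?M ?len \<omega> \<le> 0"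
          using elim(1) True mean_eqs[OF a] by (simp add: inner_vec_def)
        ultimately show ?thesis using True elim(2) by (simp add: mult.assoc)
      qed simp
    qed
  qed
  \<comment> \<open>Back from the survival probability under the frame law to that of the actual frame.\<close>
  also have "\<dots> = (LINT \<omega>|pspace R. ?I \<omega> * (c * B) * ?tail (?o \<omega>)) + (LINT \<omega>|pspace R. ?I \<omega> * (\<rho> * B) * 1)"
    unfolding tt(3)
    by (rule Bochner_Integration.integral_add[OF tt(2)]) (simp add: P.emeasure_eq_measure)
  also have "(LINT \<omega>|pspace R. ?I \<omega> * (c * B) * ?tail (?o \<omega>)) =
      (LINT \<omega>|pspace R. (c * B) * indicator {\<omega> \<in> starts n k t. s \<le> frame_len R n k \<omega>} \<omega>)"
    by (intro Bochner_Integration.integral_cong) (auto simp: indicator_def fst_o)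
  also have "\<dots> = c * B * measure (pspace R) {\<omega> \<in> starts n k t. s \<le> frame_len R n k \<omega>}"
    by simp
  also have "(LINT \<omega>|pspace R. ?I \<omega> * (\<rho> * B) * 1) = \<rho> * B * measure (pspace R) (starts n k t)"
    by simp
  finally show "(LINT \<omega>|pspace R. X \<omega>) \<le>
      c * B * measure (pspace R) {\<omega> \<in> starts n k t. s \<le> frame_len R n k \<omega>}
      + \<rho> * B * measure (pspace R) (starts n k t)" .
qed

end

context bounded_run
begin

lemma pen_sum_frame_out:
  "pen_sum (frame_out R n k \<omega>) = (\<Sum>i<frame_len R n k \<omega>. pen R n (rtime R n k \<omega> + i) \<omega>)"
  by (simp add: pen_sum_def frame_out_def)

lemma met_sum_frame_out:
  "met_sum l (frame_out R n k \<omega>) = (\<Sum>i<frame_len R n k \<omega>. met R n (rtime R n k \<omega> + i) \<omega> $ l)"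
  by (simp add: met_sum_def frame_out_def)

lemma straddling_probabilities:
  "(\<Sum>k<K. \<Sum>s<T. measure (pspace R) {\<omega> \<in> starts n k s. T - s \<le> frame_len R n k \<omega>}) \<le> 1"
proof -
  have S [measurable]: "{\<omega> \<in> starts n k s. T - s \<le> frame_len R n k \<omega>} \<in> sets (pspace R)" for k s
    by measurable
  let ?f = "\<lambda>\<omega>. \<Sum>k<K. \<Sum>s<T. indicator {\<omega> \<in> starts n k s. T - s \<le> frame_len R n k \<omega>} \<omega> :: real"
  have i: "integrable (pspace R) (indicator {\<omega> \<in> starts n k s. T - s \<le> frame_len R n k \<omega>} :: _ \<Rightarrow> real)" for k s
    using S by (simp add: P.emeasure_eq_measure)
  have i2: "integrable (pspace R) ?f"
    by (intro Bochner_Integration.integrable_sum i)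
  have "(\<Sum>k<K. \<Sum>s<T. measure (pspace R) {\<omega> \<in> starts n k s. T - s \<le> frame_len R n k \<omega>})
      = (LINT \<omega>|pspace R. ?f \<omega>)"
    by (subst Bochner_Integration.integral_sum, intro Bochner_Integration.integrable_sum i)
      (subst Bochner_Integration.integral_sum, rule i, use S in simp)
  also have "\<dots> \<le> 1"
  proof (rule P.integral_le_const[OF i2], rule AE_I2)
    fix \<omega> assume \<omega>: "\<omega> \<in> space (pspace R)"
    have "?f \<omega> = (\<Sum>k<K. \<Sum>s<T. of_bool (rtime R n k \<omega> = s) *
        of_bool (T - s \<le> rtime R n (Suc k) \<omega> - rtime R n k \<omega>))"
      using \<omega> by (intro sum.cong refl) (auto simp: frame_len_def)
    also have "\<dots> \<le> 1" by (rule one_frame_straddles[OF rtime_strict_mono[OF \<omega>]])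
    finally show "?f \<omega> \<le> 1" .
  qed
  finally show ?thesis .
qed

text \<open>The central inequality.  The constant \<open>c\<close> bounds the reward of a slot under the weights of any earlier
  slot, and \<open>\<rho>\<close> is the rate at which rewards change when the weights get older.  The frame in
  progress at \<open>T\<close> contributes \<open>c * B\<close>, since the probabilities of being that frame sum up to at most
  one; each of the at most \<open>T\<close> frames contributes \<open>\<rho> * B\<close>.  Applied to negated data the inequality
  gives lower bounds.\<close>

lemma renewal_reward_le:
  fixes V c w \<rho> :: real
  assumes W: "\<And>t l. t < T \<Longrightarrow> (\<lambda>\<omega>. W t \<omega> $ l) \<in> borel_measurable (past m R t)"
    and \<theta>: "\<And>t. t < T \<Longrightarrow> \<theta> t \<in> borel_measurable (past m R t)"
    and bd: "AE \<omega> in pspace R. \<forall>t<T. (\<forall>l. \<bar>W t \<omega> $ l\<bar> \<le> w) \<and>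
      \<bar>V\<bar> * Y + (\<Sum>l\<in>UNIV. \<bar>W t \<omega> $ l\<bar>) * Z + \<bar>\<theta> t \<omega>\<bar> \<le> c"
    and drift: "AE \<omega> in pspace R. \<forall>t i. t + i < T \<longrightarrow>
      W (t + i) \<omega> \<bullet> met R n (t + i) \<omega> - \<theta> (t + i) \<omega> \<le> W t \<omega> \<bullet> met R n (t + i) \<omega> - \<theta> t \<omega> + \<rho> * real i"
    and mean: "\<And>\<omega> k t. \<omega> \<in> space (pspace R) \<Longrightarrow> t < T \<Longrightarrow> rtime R n k \<omega> = t \<Longrightarrow>
      V * yhat m n (act R n k \<omega>) + W t \<omega> \<bullet> zhat m n (act R n k \<omega>) \<le> \<theta> t \<omega> * That m n (act R n k \<omega>)"
    and \<rho>: "0 \<le> \<rho>" and c: "0 \<le> c"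
  shows "integrable (pspace R) (\<lambda>\<omega>. \<Sum>t<T. V * pen R n t \<omega> + W t \<omega> \<bullet> met R n t \<omega> - \<theta> t \<omega>)"
    and "(LINT \<omega>|pspace R. (\<Sum>t<T. V * pen R n t \<omega> + W t \<omega> \<bullet> met R n t \<omega> - \<theta> t \<omega>)) \<le> c * B + \<rho> * B * real T"
proof -
  let ?x = "\<lambda>\<omega> t. V * pen R n t \<omega> + W t \<omega> \<bullet> met R n t \<omega> - \<theta> t \<omega>"
  let ?r = "\<lambda>\<omega> s t. V * pen R n t \<omega> + W s \<omega> \<bullet> met R n t \<omega> - \<theta> s \<omega>"
  define X where "X k s \<omega> = indicator (starts n k s) \<omega> *
      (V * pen_sum (frame_out R n k \<omega>) + (\<Sum>l\<in>UNIV. W s \<omega> $ l * met_sum l (frame_out R n k \<omega>))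
        - \<theta> s \<omega> * real (frame_len R n k \<omega>) + c * max (real (frame_len R n k \<omega>) - real (T - s)) 0
        + \<rho> * (real (frame_len R n k \<omega>))\<^sup>2)" for k s \<omega>
  have W_bd: "AE \<omega> in pspace R. \<bar>W t \<omega> $ l\<bar> \<le> w" if "t < T" for t l
    using bd by eventually_elim (use that in blast)
  have \<theta>_bd: "AE \<omega> in pspace R. \<bar>\<theta> t \<omega>\<bar> \<le> c" if "t < T" for t
    using bd
  proof eventually_elim
    case (elim \<omega>)
    have "0 \<le> \<bar>V\<bar> * Y" "0 \<le> (\<Sum>l\<in>UNIV. \<bar>W t \<omega> $ l\<bar>) * Z"
      using Y_nonneg Z_nonneg by (auto intro!: mult_nonneg_nonneg sum_nonneg)
    moreover have "\<bar>V\<bar> * Y + (\<Sum>l\<in>UNIV. \<bar>W t \<omega> $ l\<bar>) * Z + \<bar>\<theta> t \<omega>\<bar> \<le> c"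
      using elim that by blast
    ultimately show ?case by linarith
  qed
  have Xi: "integrable (pspace R) (X k s)"
    and Xle: "(LINT \<omega>|pspace R. X k s \<omega>) \<le>
      c * B * measure (pspace R) {\<omega> \<in> starts n k s. T - s \<le> frame_len R n k \<omega>}
      + \<rho> * B * measure (pspace R) (starts n k s)" if s: "s < T" for k s
  proof -
    have le: "AE \<omega> in pspace R. rtime R n k \<omega> = s \<longrightarrow>
      V * yhat m n (act R n k \<omega>) + W s \<omega> \<bullet> zhat m n (act R n k \<omega>) \<le> \<theta> s \<omega> * That m n (act R n k \<omega>)"
      using AE_space by eventually_elim (use mean s in blast)
    note wf = whole_frame_bound[OF W[OF s] W_bd[OF s] \<theta>[OF s] \<theta>_bd[OF s] le c \<rho>, of "T - s"]
    show "integrable (pspace R) (X k s)" unfolding X_def[abs_def] by (rule wf(1))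
    show "(LINT \<omega>|pspace R. X k s \<omega>) \<le>
      c * B * measure (pspace R) {\<omega> \<in> starts n k s. T - s \<le> frame_len R n k \<omega>}
      + \<rho> * B * measure (pspace R) (starts n k s)" unfolding X_def[abs_def] by (rule wf(2))
  qed
  have r_bd: "AE \<omega> in pspace R. \<forall>s<T. \<forall>t. \<bar>?r \<omega> s t\<bar> \<le> c"
    using bd AE_pen_met_bounds
  proof eventually_elim
    case (elim \<omega>)
    show ?case
    proof (intro allI impI)
      fix s t assume "s < T"
      have "\<bar>V * pen R n t \<omega>\<bar> \<le> \<bar>V\<bar> * Y" using elim by (simp add: abs_mult mult_left_mono)
      moreover have "\<bar>W s \<omega> \<bullet> met R n t \<omega>\<bar> \<le> (\<Sum>l\<in>UNIV. \<bar>W s \<omega> $ l\<bar>) * Z"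
        by (rule abs_inner_le) (use elim in blast)
      moreover have "\<bar>V\<bar> * Y + (\<Sum>l\<in>UNIV. \<bar>W s \<omega> $ l\<bar>) * Z + \<bar>\<theta> s \<omega>\<bar> \<le> c"
        using elim \<open>s < T\<close> by blast
      ultimately show "\<bar>?r \<omega> s t\<bar> \<le> c" by linarith
    qed
  qed
  have m: "(\<lambda>\<omega>. ?x \<omega> t) \<in> borel_measurable (pspace R)" if "t < T" for t
  proof -
    note [measurable] = past_measurable[OF W[OF that]] past_measurable[OF \<theta>[OF that]]
    show ?thesis unfolding inner_vec_def by measurable
  qed
  show i: "integrable (pspace R) (\<lambda>\<omega>. \<Sum>t<T. ?x \<omega> t)"
  proof (rule Bochner_Integration.integrable_sum)
    fix t assume "t \<in> {..<T}"
    then have "t < T" by simp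
    show "integrable (pspace R) (\<lambda>\<omega>. ?x \<omega> t)"
      by (rule AE_bounded_integrable[OF m[OF \<open>t < T\<close>], of c])
        (use r_bd \<open>t < T\<close> in \<open>auto elim!: eventually_mono\<close>)
  qed
  have path: "AE \<omega> in pspace R. (\<Sum>t<T. ?x \<omega> t) \<le> (\<Sum>k<T. \<Sum>s<T. X k s \<omega>)"
    using r_bd drift AE_space
  proof eventually_elim
    case (elim \<omega>)
    let ?\<tau> = "\<lambda>k. rtime R n k \<omega>"
    have "(\<Sum>t<T. ?x \<omega> t) \<le> (\<Sum>k<T. \<Sum>s<T. of_bool (?\<tau> k = s) *
      ((\<Sum>i<?\<tau> (Suc k) - ?\<tau> k. ?r \<omega> s (s + i)) + c * max (real (?\<tau> (Suc k) - ?\<tau> k) - real (T - s)) 0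
        + \<rho> * (real (?\<tau> (Suc k) - ?\<tau> k))\<^sup>2))"
    proof (rule sum_slots_le_sum_whole_frames[OF rtime_strict_mono[OF elim(3)] rtime_0[OF elim(3)] _ _ \<rho>])
      show "\<bar>?r \<omega> s t\<bar> \<le> c" if "s < T" for s t using elim(1) that by blast
      show "?x \<omega> (s + i) \<le> ?r \<omega> s (s + i) + \<rho> * real i" if "s + i < T" for s i
        using elim(2)[rule_format, OF that] by simp
    qed
    also have "\<dots> = (\<Sum>k<T. \<Sum>s<T. X k s \<omega>)"
    proof (intro sum.cong refl)
      fix k s
      have "(\<Sum>i<frame_len R n k \<omega>. ?r \<omega> s (s + i)) = V * pen_sum (frame_out R n k \<omega>)
        + (\<Sum>l\<in>UNIV. W s \<omega> $ l * met_sum l (frame_out R n k \<omega>)) - \<theta> s \<omega> * real (frame_len R n k \<omega>)"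
        if "?\<tau> k = s"
      proof -
        have "(\<Sum>l\<in>UNIV. W s \<omega> $ l * met_sum l (frame_out R n k \<omega>))
            = (\<Sum>i<frame_len R n k \<omega>. \<Sum>l\<in>UNIV. W s \<omega> $ l * met R n (s + i) \<omega> $ l)"
          unfolding met_sum_frame_out that sum_distrib_left by (rule sum.swap)
        then show ?thesis
          unfolding pen_sum_frame_out that
          by (simp add: inner_vec_def sum.distrib sum_subtractf sum_distrib_left mult.commute)
      qed
      then show "of_bool (?\<tau> k = s) *
        ((\<Sum>i<?\<tau> (Suc k) - ?\<tau> k. ?r \<omega> s (s + i)) + c * max (real (?\<tau> (Suc k) - ?\<tau> k) - real (T - s)) 0
          + \<rho> * (real (?\<tau> (Suc k) - ?\<tau> k))\<^sup>2) = X k s \<omega>"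
        unfolding X_def using elim(3) by (auto simp: frame_len_def)
    qed
    finally show ?case .
  qed
  have "(LINT \<omega>|pspace R. (\<Sum>t<T. ?x \<omega> t)) \<le> (LINT \<omega>|pspace R. (\<Sum>k<T. \<Sum>s<T. X k s \<omega>))"
    by (rule integral_mono_AE[OF i _ path]) (auto intro!: Xi)
  also have "\<dots> = (\<Sum>k<T. LINT \<omega>|pspace R. (\<Sum>s<T. X k s \<omega>))"
    by (rule Bochner_Integration.integral_sum) (auto intro!: Xi)
  also have "\<dots> = (\<Sum>k<T. \<Sum>s<T. LINT \<omega>|pspace R. X k s \<omega>)"
    by (intro sum.cong refl Bochner_Integration.integral_sum) (auto intro!: Xi)
  also have "\<dots> \<le> (\<Sum>k<T. \<Sum>s<T.
      c * B * measure (pspace R) {\<omega> \<in> starts n k s. T - s \<le> frame_len R n k \<omega>}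
      + \<rho> * B * measure (pspace R) (starts n k s))"
    by (intro sum_mono Xle) auto
  also have "\<dots> = c * B * (\<Sum>k<T. \<Sum>s<T. measure (pspace R) {\<omega> \<in> starts n k s. T - s \<le> frame_len R n k \<omega>})
      + \<rho> * B * (\<Sum>k<T. \<Sum>s<T. measure (pspace R) (starts n k s))"
    by (simp only: sum.distrib sum_distrib_left)
  also have "\<dots> \<le> c * B * 1 + \<rho> * B * (\<Sum>k<T. 1)"
    using straddling_probabilities c \<rho> B_ge_1 starts_disjoint_sum
    by (intro add_mono mult_left_mono sum_mono) auto
  finally show "(LINT \<omega>|pspace R. (\<Sum>t<T. ?x \<omega> t)) \<le> c * B + \<rho> * B * real T" by simp
qed

end

section \<open>Weak duality\<close>

context bounded_renewal
begin

definition cost :: "'n \<Rightarrow> real \<Rightarrow> real^'l \<Rightarrow> 'a \<Rightarrow> real" where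
  "cost n V q a = V * fhat m n a + q \<bullet> ghat m n a"

definition min_cost :: "'n \<Rightarrow> real \<Rightarrow> real^'l \<Rightarrow> real" where
  "min_cost n V q = (INF a\<in>space (actions m n). cost n V q a)"

definition cost_bound :: "real \<Rightarrow> real^'l \<Rightarrow> real" where
  "cost_bound V q = \<bar>V\<bar> * Y + (\<Sum>l\<in>UNIV. \<bar>q $ l\<bar>) * Z"

lemma cost_bound_nonneg: "0 \<le> cost_bound V q"
  unfolding cost_bound_def using Y_nonneg Z_nonneg by (intro add_nonneg_nonneg mult_nonneg_nonneg sum_nonneg) auto

context
  fixes n :: 'n and a :: 'a
  assumes a: "a \<in> space (actions m n)"
begin

interpretation K: prob_space "frame_law m n 0 a" by (rule prob_space_law[OF a])

lemma That_ge_1: "1 \<le> That m n a"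
proof -
  have "(LINT w|frame_law m n 0 a. 1) \<le> (LINT w|frame_law m n 0 a. real (fst w))"
    by (rule integral_mono_AE)
      (use quadratic_integrable(1)[OF quadratic_len a, of 0] AE_len_ge_1[OF a, of 0] in
        \<open>auto elim!: eventually_mono\<close>)
  then show ?thesis using mean_eqs(3)[OF a, of 0] K.prob_space by simp
qed

lemma yhat_le: "\<bar>yhat m n a\<bar> \<le> Y * That m n a"
proof -
  have "\<bar>LINT w|frame_law m n 0 a. pen_sum w\<bar> \<le> (LINT w|frame_law m n 0 a. \<bar>pen_sum w\<bar>)"
    by (rule integral_abs_bound)
  also have "\<dots> \<le> (LINT w|frame_law m n 0 a. Y * real (fst w))"
    by (rule integral_mono_AE[OF _ _ AE_pen_sum_le[OF a]])
      (use quadratic_integrable(1)[OF quadratic_len a, of 0] quadratic_integrable(1)[OF quadratic_pen_sum a, of 0] in auto)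
  finally show ?thesis using mean_eqs[OF a, of 0] by simp
qed

lemma zhat_le: "\<bar>zhat m n a $ l\<bar> \<le> Z * That m n a"
proof -
  have "\<bar>LINT w|frame_law m n 0 a. met_sum l w\<bar> \<le> (LINT w|frame_law m n 0 a. \<bar>met_sum l w\<bar>)"
    by (rule integral_abs_bound)
  also have "\<dots> \<le> (LINT w|frame_law m n 0 a. Z * real (fst w))"
    by (rule integral_mono_AE[OF _ _ AE_met_sum_le[OF a]])
      (use quadratic_integrable(1)[OF quadratic_len a, of 0] quadratic_integrable(1)[OF quadratic_met_sum a, of 0] in auto)
  finally show ?thesis using mean_eqs[OF a, of 0] by simp
qed

lemma fhat_le: "\<bar>fhat m n a\<bar> \<le> Y"
  using yhat_le That_ge_1 by (simp add: fhat_def abs_divide divide_le_eq)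

lemma ghat_le: "\<bar>ghat m n a $ l\<bar> \<le> Z"
  using zhat_le[of l] That_ge_1 by (simp add: ghat_def abs_mult divide_le_eq field_simps)

lemma cost_mult_That: "cost n V q a * That m n a = V * yhat m n a + q \<bullet> zhat m n a"
  using That_ge_1 by (simp add: cost_def fhat_def ghat_def field_simps)

lemma abs_cost_le: "\<bar>cost n V q a\<bar> \<le> cost_bound V q"
proof -
  have "\<bar>V * fhat m n a\<bar> \<le> \<bar>V\<bar> * Y" using fhat_le by (simp add: abs_mult mult_left_mono)
  moreover have "\<bar>q \<bullet> ghat m n a\<bar> \<le> (\<Sum>l\<in>UNIV. \<bar>q $ l\<bar>) * Z" by (rule abs_inner_le[OF ghat_le])
  ultimately show ?thesis unfolding cost_def cost_bound_def by linarith
qed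

lemma cost_diff_le: "\<bar>cost n V q a - cost n V q' a\<bar> \<le> (\<Sum>l\<in>UNIV. \<bar>q $ l - q' $ l\<bar>) * Z"
  using abs_inner_le[OF ghat_le, of "q - q'"] by (simp add: cost_def inner_diff_left)

lemma in_perf_P: "(fhat m n a, ghat m n a) \<in> perf_P m n"
proof -
  have "(yhat m n a, zhat m n a, That m n a) \<in> perf_S m n"
    unfolding perf_S_def using a by (intro hull_inc) blast
  then show ?thesis unfolding perf_P_def fhat_def ghat_def by blast
qed

end

lemma min_cost_le: "a \<in> space (actions m n) \<Longrightarrow> min_cost n V q \<le> cost n V q a"
  unfolding min_cost_def
  by (rule cINF_lower) (use abs_cost_le[of _ n V q] in \<open>force intro!: bdd_belowI[of _ "- cost_bound V q"] simp: abs_le_iff\<close>)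

context
  fixes n :: 'n
  assumes ne: "space (actions m n) \<noteq> {}"
begin

lemma min_cost_greatest: "(\<And>a. a \<in> space (actions m n) \<Longrightarrow> x \<le> cost n V q a) \<Longrightarrow> x \<le> min_cost n V q"
  unfolding min_cost_def by (rule cINF_greatest[OF ne])

lemma abs_min_cost_le: "\<bar>min_cost n V q\<bar> \<le> cost_bound V q"
proof -
  obtain a where a: "a \<in> space (actions m n)" using ne by blast
  have "min_cost n V q \<le> cost_bound V q"
    using min_cost_le[OF a, of V q] abs_cost_le[OF a, of V q] by linarith
  moreover have "- cost_bound V q \<le> min_cost n V q"
  proof (rule min_cost_greatest)
    show "- cost_bound V q \<le> cost n V q a" if "a \<in> space (actions m n)" for a
      using abs_cost_le[OF that, of V q] by linarith
  qed
  ultimately show ?thesis by linarith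
qed

text \<open>An infimum of functions of \<open>q\<close> with a common Lipschitz constant inherits it.  This controls how
  \<open>min_cost\<close> moves with the queues inside a frame, and makes it a measurable function of them.\<close>

lemma min_cost_diff_le: "\<bar>min_cost n V q - min_cost n V q'\<bar> \<le> (\<Sum>l\<in>UNIV. \<bar>q $ l - q' $ l\<bar>) * Z"
proof -
  have "min_cost n V p - (\<Sum>l\<in>UNIV. \<bar>p $ l - p' $ l\<bar>) * Z \<le> min_cost n V p'" for p p'
  proof (rule min_cost_greatest)
    fix a assume a: "a \<in> space (actions m n)"
    show "min_cost n V p - (\<Sum>l\<in>UNIV. \<bar>p $ l - p' $ l\<bar>) * Z \<le> cost n V p' a"
      using min_cost_le[OF a, of V p] cost_diff_le[OF a, of V p p'] by linarith
  qed
  from this[of q q'] this[of q' q] show ?thesis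
    by (simp add: abs_minus_commute abs_le_iff)
qed

lemma min_cost_measurable [measurable]: "min_cost n V \<in> borel_measurable borel"
proof (rule borel_measurable_continuous_onI, rule lipschitz_on_continuous_on)
  show "(real CARD('l) * Z)-lipschitz_on UNIV (min_cost n V)"
  proof (rule lipschitz_onI)
    fix q q' :: "real^'l"
    have "(\<Sum>l\<in>UNIV. \<bar>q $ l - q' $ l\<bar>) \<le> (\<Sum>l\<in>(UNIV :: 'l set). dist q q')"
      using component_le_norm_cart[of "q - q'"] by (intro sum_mono) (simp add: dist_norm)
    then have "(\<Sum>l\<in>UNIV. \<bar>q $ l - q' $ l\<bar>) * Z \<le> real CARD('l) * Z * dist q q'"
      using mult_right_mono[OF _ Z_nonneg] by (fastforce simp: mult_ac)
    then show "dist (min_cost n V q) (min_cost n V q') \<le> real CARD('l) * Z * dist q q'"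
      using min_cost_diff_le[of V q q'] by (simp add: dist_real_def)
  qed (simp add: Z_nonneg)
qed

end

end

context bounded_run
begin

lemma actions_nonempty: "space (actions m n) \<noteq> {}"
  using act_in P.not_empty by blast

lemma avg_pen_eq: "0 < T \<Longrightarrow> (\<Sum>n\<in>UNIV. \<Sum>t<T. LINT \<omega>|pspace R. pen R n t \<omega>) = real T * avg_pen R T"
  unfolding avg_pen_def by (subst sum.swap) simp

lemma avg_met_eq: "0 < T \<Longrightarrow> (\<Sum>n\<in>UNIV. \<Sum>t<T. LINT \<omega>|pspace R. met R n t \<omega> $ l) = real T * avg_met R l T"
  unfolding avg_met_def by (subst sum.swap) simp

text \<open>No action can beat \<open>min_cost\<close>, so the renewal-reward inequality applies to the negated constant
  weights; constant weights make no age error.\<close>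

lemma constant_weights_lower:
  "real T * min_cost n V q - 2 * cost_bound V q * B
    \<le> V * (\<Sum>t<T. LINT \<omega>|pspace R. pen R n t \<omega>) + (\<Sum>l\<in>UNIV. q $ l * (\<Sum>t<T. LINT \<omega>|pspace R. met R n t \<omega> $ l))"
proof -
  let ?\<theta> = "min_cost n V q"
  have abs: "\<bar>q $ l\<bar> \<le> (\<Sum>l\<in>UNIV. \<bar>q $ l\<bar>)" for l by (rule member_le_sum) auto
  have *: "(LINT \<omega>|pspace R. (\<Sum>t<T. (- V) * pen R n t \<omega> + (- q) \<bullet> met R n t \<omega> - (- ?\<theta>)))
      \<le> (2 * cost_bound V q) * B + 0 * B * real T"
  proof (rule renewal_reward_le(2)[where w="\<Sum>l\<in>UNIV. \<bar>q $ l\<bar>"])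
    show "AE \<omega> in pspace R. \<forall>t<T. (\<forall>l. \<bar>(- q) $ l\<bar> \<le> (\<Sum>l\<in>UNIV. \<bar>q $ l\<bar>)) \<and>
      \<bar>- V\<bar> * Y + (\<Sum>l\<in>UNIV. \<bar>(- q) $ l\<bar>) * Z + \<bar>- ?\<theta>\<bar> \<le> 2 * cost_bound V q"
      using abs_min_cost_le[OF actions_nonempty, of n V q] abs by (auto simp: cost_bound_def algebra_simps)
    show "(- V) * yhat m n (act R n k \<omega>) + (- q) \<bullet> zhat m n (act R n k \<omega>) \<le> - ?\<theta> * That m n (act R n k \<omega>)"
      if "\<omega> \<in> space (pspace R)" for \<omega> k
    proof -
      note a = act_in[OF that, of n k]
      have "?\<theta> * That m n (act R n k \<omega>) \<le> cost n V q (act R n k \<omega>) * That m n (act R n k \<omega>)"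
        using That_ge_1[OF a] by (intro mult_right_mono min_cost_le a) auto
      then show ?thesis unfolding cost_mult_That[OF a] by simp
    qed
  qed (auto simp: cost_bound_nonneg)
  have i: "integrable (pspace R) (\<lambda>\<omega>. q \<bullet> met R n t \<omega>)" for t
    unfolding inner_vec_def by (auto intro!: met_integrable)
  have "(LINT \<omega>|pspace R. (\<Sum>t<T. (- V) * pen R n t \<omega> + (- q) \<bullet> met R n t \<omega> - (- ?\<theta>)))
      = (\<Sum>t<T. - V * (LINT \<omega>|pspace R. pen R n t \<omega>) - (LINT \<omega>|pspace R. q \<bullet> met R n t \<omega>) + ?\<theta>)"
    by (simp add: pen_integrable i P.prob_space)
  also have "\<dots> = real T * ?\<theta> - V * (\<Sum>t<T. LINT \<omega>|pspace R. pen R n t \<omega>) - (\<Sum>t<T. LINT \<omega>|pspace R. q \<bullet> met R n t \<omega>)"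
    by (simp add: sum.distrib sum_subtractf sum_negf sum_distrib_left)
  also have "(\<Sum>t<T. LINT \<omega>|pspace R. q \<bullet> met R n t \<omega>) = (\<Sum>t<T. \<Sum>l\<in>UNIV. q $ l * (LINT \<omega>|pspace R. met R n t \<omega> $ l))"
    unfolding inner_vec_def by (simp add: met_integrable)
  also have "\<dots> = (\<Sum>l\<in>UNIV. q $ l * (\<Sum>t<T. LINT \<omega>|pspace R. met R n t \<omega> $ l))"
    by (subst sum.swap) (simp add: sum_distrib_left)
  finally show ?thesis using * by simp
qed

lemma avg_lower:
  assumes T: "0 < T"
  shows "(\<Sum>n\<in>UNIV. min_cost n V q) - real CARD('n) * (2 * cost_bound V q * B) / real T
    \<le> V * avg_pen R T + (\<Sum>l\<in>UNIV. q $ l * avg_met R l T)"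
proof -
  have "(\<Sum>n\<in>(UNIV :: 'n set). real T * min_cost n V q - 2 * cost_bound V q * B)
    \<le> (\<Sum>n\<in>UNIV. V * (\<Sum>t<T. LINT \<omega>|pspace R. pen R n t \<omega>) + (\<Sum>l\<in>UNIV. q $ l * (\<Sum>t<T. LINT \<omega>|pspace R. met R n t \<omega> $ l)))"
    by (intro sum_mono constant_weights_lower)
  also have "\<dots> = V * (\<Sum>n\<in>UNIV. \<Sum>t<T. LINT \<omega>|pspace R. pen R n t \<omega>)
      + (\<Sum>n\<in>UNIV. \<Sum>l\<in>UNIV. q $ l * (\<Sum>t<T. LINT \<omega>|pspace R. met R n t \<omega> $ l))"
    by (simp only: sum.distrib sum_distrib_left)
  also have "(\<Sum>n\<in>(UNIV :: 'n set). \<Sum>l\<in>UNIV. q $ l * (\<Sum>t<T. LINT \<omega>|pspace R. met R n t \<omega> $ l))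
      = (\<Sum>l\<in>UNIV. q $ l * (\<Sum>n\<in>UNIV. \<Sum>t<T. LINT \<omega>|pspace R. met R n t \<omega> $ l))"
    by (subst sum.swap) (simp only: sum_distrib_left)
  also have "V * (\<Sum>n\<in>UNIV. \<Sum>t<T. LINT \<omega>|pspace R. pen R n t \<omega>) + \<dots>
      = real T * (V * avg_pen R T + (\<Sum>l\<in>UNIV. q $ l * avg_met R l T))"
    unfolding avg_pen_eq[OF T] avg_met_eq[OF T] by (simp add: algebra_simps sum_distrib_left)
  also have "(\<Sum>n\<in>(UNIV :: 'n set). real T * min_cost n V q - 2 * cost_bound V q * B)
      = real T * ((\<Sum>n\<in>UNIV. min_cost n V q) - real CARD('n) * (2 * cost_bound V q * B) / real T)"
    using T by (simp add: sum_subtractf sum_distrib_left right_diff_distrib)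
  finally show ?thesis using T by simp
qed

text \<open>For large \<open>T\<close> the average metrics are below \<open>d + \<delta>\<close> and the boundary error of \<open>avg_lower\<close> is below \<open>\<delta>\<close>.\<close>

lemma weak_duality_run:
  assumes V: "0 < V" and q: "\<And>l. 0 \<le> q $ l"
    and met: "\<And>l. limsup (\<lambda>T. ereal (avg_met R l T)) \<le> ereal (d $ l)"
  shows "ereal (((\<Sum>n\<in>UNIV. min_cost n V q) - q \<bullet> d) / V) \<le> limsup (\<lambda>T. ereal (avg_pen R T))"
proof (rule ereal_le_epsilon2)
  fix e :: real assume e: "0 < e"
  let ?S = "\<Sum>l\<in>UNIV. q $ l"
  have S: "0 \<le> ?S" using q by (intro sum_nonneg) auto
  \<comment> \<open>One \<open>\<delta>\<close> for the boundary error and \<open>?S * \<delta>\<close> for the metrics, which together make \<open>e * V\<close>.\<close>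
  define \<delta> where "\<delta> = e * V / (1 + ?S)"
  have \<delta>: "0 < \<delta>" using e V S by (simp add: \<delta>_def)
  let ?c = "real CARD('n) * (2 * cost_bound V q * B)"
  have "((\<lambda>T. ?c / real T) \<longlongrightarrow> 0) sequentially"
    by (rule tendsto_divide_0[OF tendsto_const filterlim_at_top_imp_at_infinity[OF filterlim_real_sequentially]])
  then have "eventually (\<lambda>T. ?c / real T < \<delta>) sequentially"
    using \<delta> order_tendstoD(2) by blast
  moreover have "eventually (\<lambda>T. \<forall>l\<in>UNIV. avg_met R l T < d $ l + \<delta>) sequentially"
  proof (rule eventually_ball_finite[OF finite], rule ballI)
    fix l
    have "limsup (\<lambda>T. ereal (avg_met R l T)) < ereal (d $ l + \<delta>)"
      by (rule le_less_trans[OF met[of l]]) (use \<delta> in simp)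
    from Limsup_lessD[OF this] show "eventually (\<lambda>T. avg_met R l T < d $ l + \<delta>) sequentially"
      by simp
  qed
  ultimately have "eventually (\<lambda>T. ereal (((\<Sum>n\<in>UNIV. min_cost n V q) - q \<bullet> d) / V - e) \<le> ereal (avg_pen R T)) sequentially"
    using eventually_gt_at_top[of 0]
  proof eventually_elim
    case (elim T)
    have "(\<Sum>l\<in>UNIV. q $ l * avg_met R l T) \<le> (\<Sum>l\<in>UNIV. q $ l * (d $ l + \<delta>))"
      by (intro sum_mono mult_left_mono q) (use elim(2) in \<open>auto intro: less_imp_le\<close>)
    also have "\<dots> = q \<bullet> d + ?S * \<delta>"
      by (simp add: inner_vec_def distrib_left sum.distrib sum_distrib_right)
    finally have "(\<Sum>n\<in>UNIV. min_cost n V q) - \<delta> \<le> V * avg_pen R T + (q \<bullet> d + ?S * \<delta>)"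
      using avg_lower[OF elim(3), of V q] elim(1) by linarith
    then have "(\<Sum>n\<in>UNIV. min_cost n V q) - q \<bullet> d - (1 + ?S) * \<delta> \<le> V * avg_pen R T"
      by (simp add: algebra_simps)
    also have "(1 + ?S) * \<delta> = e * V" using S by (simp add: \<delta>_def)
    finally show ?case using V by (simp add: field_simps)
  qed
  then have "ereal (((\<Sum>n\<in>UNIV. min_cost n V q) - q \<bullet> d) / V - e) \<le> limsup (\<lambda>T. ereal (avg_pen R T))"
    by (intro le_Limsup) auto
  then show "ereal (((\<Sum>n\<in>UNIV. min_cost n V q) - q \<bullet> d) / V) \<le> limsup (\<lambda>T. ereal (avg_pen R T)) + ereal e"
    by (cases "limsup (\<lambda>T. ereal (avg_pen R T))") auto
qed

end

lemma (in bounded_renewal) weak_duality: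
  assumes "0 < V" "\<And>l. 0 \<le> q $ l"
  shows "ereal (((\<Sum>n\<in>UNIV. min_cost n V q) - q \<bullet> ext_mean m) / V) \<le> f_star m"
  unfolding f_star_def
proof (rule Inf_greatest, elim CollectE exE conjE, hypsubst)
  fix R :: "(('n, 'l, 'a) trajectory, 'n, 'l, 'a) run"
  assume R: "admissible m R"
  then interpret bounded_run m Y Z D B R
    by unfold_locales (simp add: admissible_def)
  show "ereal (((\<Sum>n\<in>UNIV. min_cost n V q) - q \<bullet> ext_mean m) / V) \<le> limsup (\<lambda>T. ereal (avg_pen R T))"
    by (rule weak_duality_run[OF assms]) (use R in \<open>simp add: admissible_def\<close>)
qed

section \<open>Drift of the virtual queues\<close>

text \<open>The largest change of a queue in one slot.  The model enters through its type, which carries the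
  number of systems.\<close>

definition max_step :: "('n::finite, 'l::finite, 'a) model \<Rightarrow> real \<Rightarrow> real \<Rightarrow> real" where
  "max_step (m :: ('n, 'l, 'a) model) Z D = real CARD('n) * Z + D"

context bounded_renewal
begin

abbreviation slope :: real where "slope \<equiv> max_step m Z D"

lemma slope_nonneg: "0 \<le> slope"
  using Z_nonneg D_nonneg by (simp add: max_step_def)

end

context bounded_run
begin

lemma queue_nonneg: "0 \<le> queue R t \<omega> $ l"
  by (cases t) auto

lemma queue_past: "s \<le> t \<Longrightarrow> (\<lambda>\<omega>. queue R s \<omega> $ l) \<in> borel_measurable (past m R t)"
proof (induction s)
  case (Suc s)
  then have st: "s < t" by simp
  note [measurable] = met_past[OF st] ext_past[OF st] Suc.IH[OF less_imp_le[OF st]]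
  show ?case by simp
qed simp

lemma queue_vec_past: "queue R t \<in> borel_measurable (past m R t)"
proof -
  have eq: "queue R t = (\<lambda>\<omega>. \<Sum>l\<in>UNIV. queue R t \<omega> $ l *\<^sub>R axis l 1)"
  proof
    fix \<omega>
    show "queue R t \<omega> = (\<Sum>l\<in>UNIV. queue R t \<omega> $ l *\<^sub>R axis l 1)"
      using basis_expansion[of "queue R t \<omega>", symmetric] unfolding scalar_mult_eq_scaleR .
  qed
  show ?thesis
    by (subst eq) (intro borel_measurable_sum borel_measurable_scaleR queue_past borel_measurable_const order_refl)
qed

context
  fixes \<omega> assumes met: "\<And>n t l. \<bar>met R n t \<omega> $ l\<bar> \<le> Z" and ext: "\<And>t l. \<bar>ext R t \<omega> $ l\<bar> \<le> D"
begin

lemma increment_le: "\<bar>(\<Sum>n\<in>UNIV. met R n t \<omega> $ l) - ext R t \<omega> $ l\<bar> \<le> slope"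
proof -
  have "\<bar>\<Sum>n\<in>UNIV. met R n t \<omega> $ l\<bar> \<le> (\<Sum>n\<in>(UNIV :: 'n set). Z)"
    by (intro order_trans[OF sum_abs] sum_mono met)
  then show ?thesis using ext[of t l] by (simp add: max_step_def)
qed

lemma queue_step_le: "\<bar>queue R (Suc t) \<omega> $ l - queue R t \<omega> $ l\<bar> \<le> slope"
  using increment_le[of t l] queue_nonneg[of t \<omega> l] slope_nonneg by (simp add: max_def abs_le_iff)

lemma queue_diff_le: "\<bar>queue R (t + i) \<omega> $ l - queue R t \<omega> $ l\<bar> \<le> slope * real i"
proof (induction i)
  case (Suc i)
  then show ?case using queue_step_le[of "t + i" l] by (simp add: distrib_left del: queue.simps)
qed simp

lemma queue_le: "queue R t \<omega> $ l \<le> slope * real t"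
  using queue_diff_le[of 0 t l] by simp

lemma queue_ge_sum: "(\<Sum>t<T. (\<Sum>n\<in>UNIV. met R n t \<omega> $ l) - ext R t \<omega> $ l) \<le> queue R T \<omega> $ l"
  by (induction T) auto

lemma queue_square_le:
  "(queue R T \<omega> $ l)\<^sup>2 \<le> (\<Sum>t<T. 2 * queue R t \<omega> $ l * ((\<Sum>n\<in>UNIV. met R n t \<omega> $ l) - ext R t \<omega> $ l)) + slope\<^sup>2 * real T"
proof (induction T)
  case (Suc T)
  let ?q = "queue R T \<omega> $ l" and ?i = "(\<Sum>n\<in>UNIV. met R n T \<omega> $ l) - ext R T \<omega> $ l"
  have "(queue R (Suc T) \<omega> $ l)\<^sup>2 \<le> (?q + ?i)\<^sup>2"
    by (simp add: max_def add_diff_eq)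
  also have "\<dots> = ?q\<^sup>2 + 2 * ?q * ?i + ?i\<^sup>2" by (simp add: power2_sum)
  also have "?i\<^sup>2 \<le> slope\<^sup>2" using increment_le[of T l] slope_nonneg by (simp add: abs_le_square_iff[symmetric])
  finally show ?case using Suc by (simp add: distrib_left del: queue.simps)
qed simp

end

lemma AE_met_ext: "AE \<omega> in pspace R. (\<forall>n t l. \<bar>met R n t \<omega> $ l\<bar> \<le> Z) \<and> (\<forall>t l. \<bar>ext R t \<omega> $ l\<bar> \<le> D)"
  using AE_pen_met_bounds AE_ext_bound by eventually_elim blast

lemma queue_measurable [measurable]: "(\<lambda>\<omega>. queue R t \<omega> $ l) \<in> borel_measurable (pspace R)"
  by (rule past_measurable[OF queue_past[OF order_refl]])

lemma AE_queue_le: "AE \<omega> in pspace R. \<forall>t l. \<bar>queue R t \<omega> $ l\<bar> \<le> slope * real t"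
  using AE_met_ext
proof eventually_elim
  case (elim \<omega>)
  then show ?case using queue_le[of \<omega>] queue_nonneg by (auto simp: abs_le_iff intro: order_trans[of _ 0])
qed

lemma queue_integrable: "integrable (pspace R) (\<lambda>\<omega>. queue R t \<omega> $ l)"
  by (rule AE_bounded_integrable[of _ "slope * real t"]) (use AE_queue_le in \<open>auto elim!: eventually_mono\<close>)

lemma queue_square_integrable: "integrable (pspace R) (\<lambda>\<omega>. (queue R t \<omega> $ l)\<^sup>2)"
proof (rule AE_bounded_integrable[of _ "(slope * real t)\<^sup>2"])
  show "AE \<omega> in pspace R. \<bar>(queue R t \<omega> $ l)\<^sup>2\<bar> \<le> (slope * real t)\<^sup>2"
    using AE_queue_le
  proof eventually_elim
    case (elim \<omega>)
    then show ?case using power_mono[of "\<bar>queue R t \<omega> $ l\<bar>" "slope * real t" 2] by simp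
  qed
qed measurable

lemma ext_expectation: "(LINT \<omega>|pspace R. ext R t \<omega> $ l) = ext_mean m $ l"
proof -
  have "ext_mean m $ l = (LINT x|distr (pspace R) borel (ext R t). x $ l)"
    unfolding ext_distr by (simp add: ext_mean_def)
  also have "\<dots> = (LINT \<omega>|pspace R. ext R t \<omega> $ l)"
    by (rule integral_distr) measurable
  finally show ?thesis by simp
qed

text \<open>Events of the form \<open>ext R t \<omega> $ l \<in> A\<close> already form a sigma-algebra, and each of them is among the events
  whose independence of the past is assumed.\<close>

lemma ext_indep:
  fixes X :: "'w \<Rightarrow> real"
  assumes X: "X \<in> borel_measurable (past m R t)"
  shows "P.indep_var borel X borel (\<lambda>\<omega>. ext R t \<omega> $ l)"
proof -
  have ind: "P.indep_set (sets (past m R t)) {{\<omega> \<in> space (pspace R). ext R t \<omega> \<in> U} |U. U \<in> sets borel}"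
    using run unfolding renewal_run_def external_iid_def by blast
  have "sigma_sets (space (pspace R)) {X -` A \<inter> space (pspace R) |A. A \<in> sets borel} \<subseteq> sets (past m R t)"
  proof -
    have "{X -` A \<inter> space (past m R t) |A. A \<in> sets borel} \<subseteq> sets (past m R t)"
      using measurable_sets[OF X] by blast
    from sets.sigma_sets_subset[OF this] show ?thesis by simp
  qed
  moreover have "sigma_sets (space (pspace R)) {(\<lambda>\<omega>. ext R t \<omega> $ l) -` A \<inter> space (pspace R) |A. A \<in> sets borel}
      \<subseteq> {{\<omega> \<in> space (pspace R). ext R t \<omega> \<in> U} |U. U \<in> sets borel}"
  proof -
    have "{(\<lambda>\<omega>. ext R t \<omega> $ l) -` A \<inter> space (pspace R) |A. A \<in> sigma_sets UNIV (sets borel)}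
        = sigma_sets (space (pspace R)) {(\<lambda>\<omega>. ext R t \<omega> $ l) -` A \<inter> space (pspace R) |A. A \<in> sets borel}"
      by (rule sigma_sets_vimage_commute) auto
    moreover have "sigma_sets UNIV (sets borel) = (sets borel :: real set set)"
      using sets.sigma_sets_eq[of "borel :: real measure"] by simp
    moreover have "(\<lambda>\<omega>. ext R t \<omega> $ l) -` A \<inter> space (pspace R)
        \<in> {{\<omega> \<in> space (pspace R). ext R t \<omega> \<in> U} |U. U \<in> sets borel}" if A: "A \<in> sets borel" for A
    proof -
      have "(\<lambda>x :: real^'l. x $ l) -` A \<inter> space borel \<in> sets borel"
        by (rule measurable_sets[OF _ A]) measurable
      moreover have "(\<lambda>\<omega>. ext R t \<omega> $ l) -` A \<inter> space (pspace R)
        = {\<omega> \<in> space (pspace R). ext R t \<omega> \<in> (\<lambda>x. x $ l) -` A \<inter> space borel}" by auto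
      ultimately show ?thesis by blast
    qed
    ultimately show ?thesis by (auto simp: subset_iff)
  qed
  ultimately have "P.indep_set (sigma_sets (space (pspace R)) {X -` A \<inter> space (pspace R) |A. A \<in> sets borel})
      (sigma_sets (space (pspace R)) {(\<lambda>\<omega>. ext R t \<omega> $ l) -` A \<inter> space (pspace R) |A. A \<in> sets borel})"
    using ind unfolding P.indep_set_def
    by (elim P.indep_sets_mono_sets) (auto split: bool.split)
  then show ?thesis
    unfolding P.indep_var_eq using past_measurable[OF X] by simp
qed

lemma queue_ext_expectation:
  "integrable (pspace R) (\<lambda>\<omega>. queue R t \<omega> $ l * ext R t \<omega> $ l)"
  "(LINT \<omega>|pspace R. queue R t \<omega> $ l * ext R t \<omega> $ l) = (LINT \<omega>|pspace R. queue R t \<omega> $ l) * ext_mean m $ l"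
proof -
  note ind = ext_indep[OF queue_past[OF order_refl], of t l l]
  from P.indep_var_integrable[OF ind queue_integrable ext_integrable]
    P.indep_var_lebesgue_integral[OF ind queue_integrable ext_integrable]
  show "integrable (pspace R) (\<lambda>\<omega>. queue R t \<omega> $ l * ext R t \<omega> $ l)"
    "(LINT \<omega>|pspace R. queue R t \<omega> $ l * ext R t \<omega> $ l) = (LINT \<omega>|pspace R. queue R t \<omega> $ l) * ext_mean m $ l"
    by (simp_all add: ext_expectation)
qed

text \<open>Truncation at zero only raises the queue, so the queue dominates the accumulated excess of the
  metrics over the external process.\<close>

lemma queue_expectation_ge:
  assumes "0 < T"
  shows "real T * (avg_met R l T - ext_mean m $ l) \<le> (LINT \<omega>|pspace R. queue R T \<omega> $ l)"
proof -
  have i: "integrable (pspace R) (\<lambda>\<omega>. (\<Sum>n\<in>UNIV. met R n t \<omega> $ l) - ext R t \<omega> $ l)" for t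
    by (intro Bochner_Integration.integrable_diff Bochner_Integration.integrable_sum met_integrable ext_integrable)
  have "(LINT \<omega>|pspace R. (\<Sum>t<T. (\<Sum>n\<in>UNIV. met R n t \<omega> $ l) - ext R t \<omega> $ l)) \<le> (LINT \<omega>|pspace R. queue R T \<omega> $ l)"
  proof (rule integral_mono_AE[OF _ queue_integrable])
    show "AE \<omega> in pspace R. (\<Sum>t<T. (\<Sum>n\<in>UNIV. met R n t \<omega> $ l) - ext R t \<omega> $ l) \<le> queue R T \<omega> $ l"
      using AE_met_ext by eventually_elim (rule queue_ge_sum; blast)
  qed (use i in auto)
  also have "(LINT \<omega>|pspace R. (\<Sum>t<T. (\<Sum>n\<in>UNIV. met R n t \<omega> $ l) - ext R t \<omega> $ l))
      = (\<Sum>t<T. (\<Sum>n\<in>UNIV. LINT \<omega>|pspace R. met R n t \<omega> $ l) - ext_mean m $ l)"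
    by (simp add: i met_integrable ext_integrable ext_expectation)
  also have "\<dots> = real T * (avg_met R l T - ext_mean m $ l)"
    using assms by (simp add: sum_subtractf avg_met_def right_diff_distrib)
  finally show ?thesis .
qed

lemma algorithm_min_cost:
  assumes alg: "follows_algorithm m V R" and \<omega>: "\<omega> \<in> space (pspace R)" and t: "rtime R n k \<omega> = t"
  shows "V * yhat m n (act R n k \<omega>) + queue R t \<omega> \<bullet> zhat m n (act R n k \<omega>)
    \<le> min_cost n V (queue R t \<omega>) * That m n (act R n k \<omega>)"
proof -
  note a = act_in[OF \<omega>, of n k]
  obtain \<phi> where \<phi>: "\<forall>\<omega>\<in>space (pspace R).
        let Q = queue R (rtime R n k \<omega>) \<omega>; \<alpha> = act R n k \<omega> in
        \<alpha> = \<phi> Q \<and>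
        (\<forall>a\<in>space (actions m n).
           V * fhat m n \<alpha> + Q \<bullet> ghat m n \<alpha> \<le> V * fhat m n a + Q \<bullet> ghat m n a)"
    using alg unfolding follows_algorithm_def by blast
  have "cost n V (queue R t \<omega>) (act R n k \<omega>) \<le> min_cost n V (queue R t \<omega>)"
    by (rule min_cost_greatest[OF actions_nonempty])
      (use \<phi>[rule_format, OF \<omega>] t in \<open>auto simp: cost_def Let_def\<close>)
  then show ?thesis
    unfolding cost_mult_That[OF a, symmetric] using That_ge_1[OF a] by (intro mult_right_mono) auto
qed

lemma cost_bound_queue:
  assumes "0 \<le> V" and q: "\<And>l. \<bar>q $ l\<bar> \<le> b"
  shows "cost_bound V q \<le> V * Y + real CARD('l) * b * Z"
proof -
  have "(\<Sum>l\<in>UNIV. \<bar>q $ l\<bar>) \<le> (\<Sum>l\<in>(UNIV :: 'l set). b)" by (intro sum_mono q)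
  then show ?thesis using assms(1) Z_nonneg by (simp add: cost_bound_def mult_right_mono)
qed

text \<open>The renewal-reward inequality with the queues as weights.  Queues at slots before \<open>T\<close> are at most
  \<open>slope * T\<close>, so the overshoot costs \<open>O(V + T)\<close>, which is affordable because the drift
  inequality is later divided by \<open>V * T\<close>.  The rate of the age error has a factor \<open>2\<close> because
  both the weights and \<open>min_cost\<close> move with the queues.\<close>

lemma algorithm_reward_le:
  fixes n :: 'n and T :: nat
  assumes alg: "follows_algorithm m V R" and V: "0 \<le> V"
  defines "G \<equiv> \<lambda>\<omega>. \<Sum>t<T. V * pen R n t \<omega> + queue R t \<omega> \<bullet> met R n t \<omega> - min_cost n V (queue R t \<omega>)"
  shows "integrable (pspace R) G"
    and "(LINT \<omega>|pspace R. G \<omega>) \<le> 2 * B * Y * V + 4 * real CARD('l) * slope * Z * B * real T"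
proof -
  let ?w = "slope * real T"
  let ?c = "2 * (V * Y + real CARD('l) * ?w * Z)"
  let ?\<rho> = "2 * real CARD('l) * slope * Z"
  have past: "(\<lambda>\<omega>. queue R t \<omega> $ l) \<in> borel_measurable (past m R t)"
    "(\<lambda>\<omega>. min_cost n V (queue R t \<omega>)) \<in> borel_measurable (past m R t)" for t l
    using queue_past[OF order_refl] measurable_compose[OF queue_vec_past min_cost_measurable[OF actions_nonempty]]
    by blast+
  have bd: "AE \<omega> in pspace R. \<forall>t<T. (\<forall>l. \<bar>queue R t \<omega> $ l\<bar> \<le> ?w) \<and>
    \<bar>V\<bar> * Y + (\<Sum>l\<in>UNIV. \<bar>queue R t \<omega> $ l\<bar>) * Z + \<bar>min_cost n V (queue R t \<omega>)\<bar> \<le> ?c"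
    using AE_queue_le
  proof eventually_elim
    case (elim \<omega>)
    show ?case
    proof (intro allI impI conjI)
      fix t assume t: "t < T"
      then have "slope * real t \<le> ?w" using slope_nonneg by (intro mult_left_mono) auto
      with elim show w: "\<bar>queue R t \<omega> $ l\<bar> \<le> ?w" for l using order_trans by blast
      have "cost_bound V (queue R t \<omega>) \<le> V * Y + real CARD('l) * ?w * Z"
        by (rule cost_bound_queue[OF V w])
      then show "\<bar>V\<bar> * Y + (\<Sum>l\<in>UNIV. \<bar>queue R t \<omega> $ l\<bar>) * Z + \<bar>min_cost n V (queue R t \<omega>)\<bar> \<le> ?c"
        using abs_min_cost_le[OF actions_nonempty, of n V "queue R t \<omega>"] unfolding cost_bound_def
        by argo
    qed
  qed
  have drift: "AE \<omega> in pspace R. \<forall>t i. t + i < T \<longrightarrow>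
    queue R (t + i) \<omega> \<bullet> met R n (t + i) \<omega> - min_cost n V (queue R (t + i) \<omega>)
      \<le> queue R t \<omega> \<bullet> met R n (t + i) \<omega> - min_cost n V (queue R t \<omega>) + ?\<rho> * real i"
    using AE_met_ext
  proof eventually_elim
    case (elim \<omega>)
    show ?case
    proof (intro allI impI)
      fix t i
      let ?q = "queue R (t + i) \<omega>" and ?q' = "queue R t \<omega>"
      have "(\<Sum>l\<in>UNIV. \<bar>?q $ l - ?q' $ l\<bar>) \<le> (\<Sum>l\<in>(UNIV :: 'l set). slope * real i)"
        by (intro sum_mono queue_diff_le) (use elim in blast)+
      then have S: "(\<Sum>l\<in>UNIV. \<bar>?q $ l - ?q' $ l\<bar>) * Z \<le> real CARD('l) * (slope * real i) * Z"
        using Z_nonneg by (intro mult_right_mono) simp_all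
      have "(?q - ?q') \<bullet> met R n (t + i) \<omega> \<le> (\<Sum>l\<in>UNIV. \<bar>?q $ l - ?q' $ l\<bar>) * Z"
        using abs_inner_le[of "met R n (t + i) \<omega>" Z "?q - ?q'"] elim by (simp add: abs_le_iff)
      moreover have "\<bar>min_cost n V ?q - min_cost n V ?q'\<bar> \<le> (\<Sum>l\<in>UNIV. \<bar>?q $ l - ?q' $ l\<bar>) * Z"
        by (rule min_cost_diff_le[OF actions_nonempty])
      moreover have "?\<rho> * real i = 2 * (real CARD('l) * (slope * real i) * Z)" by simp
      ultimately show "?q \<bullet> met R n (t + i) \<omega> - min_cost n V ?q
          \<le> ?q' \<bullet> met R n (t + i) \<omega> - min_cost n V ?q' + ?\<rho> * real i"
        using S unfolding inner_diff_left by linarith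
    qed
  qed
  have "0 \<le> ?\<rho>" "0 \<le> ?c"
    using V Y_nonneg Z_nonneg slope_nonneg by (auto intro!: mult_nonneg_nonneg add_nonneg_nonneg)
  note reward = renewal_reward_le[OF past bd drift algorithm_min_cost[OF alg] this]
  show "integrable (pspace R) G" unfolding G_def by (rule reward(1))
  have "?c * B + ?\<rho> * B * real T = 2 * B * Y * V + 4 * real CARD('l) * slope * Z * B * real T"
    by (simp add: algebra_simps)
  with reward(2) show "(LINT \<omega>|pspace R. G \<omega>) \<le> 2 * B * Y * V + 4 * real CARD('l) * slope * Z * B * real T"
    unfolding G_def by (simp only:)
qed

text \<open>Summing the squared queue updates over the slots, the inner products \<open>Q[t] \<bullet> z[t]\<close> are those of
  \<open>algorithm_reward_le\<close>, the levels \<open>min_cost n V (Q[t])\<close> sum up to at most \<open>V * fs + Q[t] \<bullet> d\<close> by weak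
  duality, and \<open>Q[t] \<bullet> (d - d[t])\<close> has mean zero by independence.\<close>

lemma drift_plus_penalty:
  assumes alg: "follows_algorithm m V R" and V: "0 < V" and fs: "f_star m = ereal fs" and T: "0 < T"
  shows "(\<Sum>l\<in>UNIV. LINT \<omega>|pspace R. (queue R T \<omega> $ l)\<^sup>2) / 2 + V * (real T * (avg_pen R T - fs))
    \<le> real CARD('n) * (2 * B * Y * V + 4 * real CARD('l) * slope * Z * B * real T)
      + real CARD('l) * slope\<^sup>2 / 2 * real T"
proof -
  define G where "G n \<omega> = (\<Sum>t<T. V * pen R n t \<omega> + queue R t \<omega> \<bullet> met R n t \<omega> - min_cost n V (queue R t \<omega>))" for n \<omega>
  let ?d = "ext_mean m"
  note Gi = algorithm_reward_le(1)[OF alg less_imp_le[OF V], of n T for n, folded G_def]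
  note Gle = algorithm_reward_le(2)[OF alg less_imp_le[OF V], of n T for n, folded G_def]
  have path: "AE \<omega> in pspace R.
    (\<Sum>l\<in>UNIV. (queue R T \<omega> $ l)\<^sup>2) / 2 + V * ((\<Sum>t<T. \<Sum>n\<in>UNIV. pen R n t \<omega>) - real T * fs)
    \<le> (\<Sum>n\<in>UNIV. G n \<omega>) + (\<Sum>t<T. \<Sum>l\<in>UNIV. queue R t \<omega> $ l * ?d $ l - queue R t \<omega> $ l * ext R t \<omega> $ l)
      + real CARD('l) * slope\<^sup>2 / 2 * real T"
    using AE_met_ext
  proof eventually_elim
    case (elim \<omega>)
    let ?Q = "\<lambda>t. queue R t \<omega>"
    have "(\<Sum>l\<in>UNIV. (?Q T $ l)\<^sup>2) \<le> (\<Sum>l\<in>UNIV. (\<Sum>t<T. 2 * ?Q t $ l *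
        ((\<Sum>n\<in>UNIV. met R n t \<omega> $ l) - ext R t \<omega> $ l)) + slope\<^sup>2 * real T)"
      by (intro sum_mono queue_square_le) (use elim in blast)+
    also have "\<dots> = 2 * (\<Sum>t<T. \<Sum>l\<in>UNIV. ?Q t $ l * ((\<Sum>n\<in>UNIV. met R n t \<omega> $ l) - ext R t \<omega> $ l))
        + real CARD('l) * slope\<^sup>2 * real T"
      by (simp add: sum.distrib sum_distrib_left mult.assoc) (rule sum.swap)
    also have "(\<Sum>t<T. \<Sum>l\<in>UNIV. ?Q t $ l * ((\<Sum>n\<in>UNIV. met R n t \<omega> $ l) - ext R t \<omega> $ l))
        = (\<Sum>t<T. (\<Sum>n\<in>UNIV. ?Q t \<bullet> met R n t \<omega>) - ?Q t \<bullet> ext R t \<omega>)"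
    proof (intro sum.cong refl)
      fix t
      have "(\<Sum>n\<in>UNIV. ?Q t \<bullet> met R n t \<omega>) = (\<Sum>l\<in>UNIV. ?Q t $ l * (\<Sum>n\<in>UNIV. met R n t \<omega> $ l))"
        unfolding inner_vec_def by (subst sum.swap) (simp add: sum_distrib_left)
      then show "(\<Sum>l\<in>UNIV. ?Q t $ l * ((\<Sum>n\<in>UNIV. met R n t \<omega> $ l) - ext R t \<omega> $ l))
        = (\<Sum>n\<in>UNIV. ?Q t \<bullet> met R n t \<omega>) - ?Q t \<bullet> ext R t \<omega>"
        by (simp add: right_diff_distrib sum_subtractf inner_vec_def)
    qed
    finally have sq: "(\<Sum>l\<in>UNIV. (?Q T $ l)\<^sup>2) / 2 \<le> (\<Sum>t<T. (\<Sum>n\<in>UNIV. ?Q t \<bullet> met R n t \<omega>) - ?Q t \<bullet> ext R t \<omega>)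
        + real CARD('l) * slope\<^sup>2 / 2 * real T" by simp
    have dual: "(\<Sum>n\<in>UNIV. min_cost n V (?Q t)) \<le> V * fs + ?Q t \<bullet> ?d" for t
    proof -
      have "((\<Sum>n\<in>UNIV. min_cost n V (?Q t)) - ?Q t \<bullet> ?d) / V \<le> fs"
        using weak_duality[OF V, of "?Q t"] queue_nonneg fs by simp
      then show ?thesis using V by (simp add: field_simps)
    qed
    have "(\<Sum>t<T. \<Sum>n\<in>UNIV. min_cost n V (?Q t)) \<le> (\<Sum>t<T. V * fs + ?Q t \<bullet> ?d)"
      by (intro sum_mono dual)
    moreover have "(\<Sum>n\<in>UNIV. G n \<omega>) = V * (\<Sum>t<T. \<Sum>n\<in>UNIV. pen R n t \<omega>)
        + (\<Sum>t<T. \<Sum>n\<in>UNIV. ?Q t \<bullet> met R n t \<omega>) - (\<Sum>t<T. \<Sum>n\<in>UNIV. min_cost n V (?Q t))"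
      unfolding G_def by (subst sum.swap) (simp add: sum.distrib sum_subtractf sum_distrib_left)
    moreover have "(\<Sum>t<T. \<Sum>l\<in>UNIV. ?Q t $ l * ?d $ l - ?Q t $ l * ext R t \<omega> $ l)
        = (\<Sum>t<T. ?Q t \<bullet> ?d) - (\<Sum>t<T. ?Q t \<bullet> ext R t \<omega>)"
      by (simp add: inner_vec_def sum_subtractf)
    ultimately show ?case using sq by (simp add: sum.distrib sum_subtractf algebra_simps)
  qed
  have "(LINT \<omega>|pspace R. (\<Sum>l\<in>UNIV. (queue R T \<omega> $ l)\<^sup>2) / 2 + V * ((\<Sum>t<T. \<Sum>n\<in>UNIV. pen R n t \<omega>) - real T * fs))
    \<le> (LINT \<omega>|pspace R. (\<Sum>n\<in>UNIV. G n \<omega>) + (\<Sum>t<T. \<Sum>l\<in>UNIV. queue R t \<omega> $ l * ?d $ l - queue R t \<omega> $ l * ext R t \<omega> $ l)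
      + real CARD('l) * slope\<^sup>2 / 2 * real T)"
    by (rule integral_mono_AE[OF _ _ path])
      (auto intro!: Bochner_Integration.integrable_add Bochner_Integration.integrable_diff Bochner_Integration.integrable_sum
        queue_square_integrable pen_integrable Gi queue_ext_expectation queue_integrable)
  also have "(LINT \<omega>|pspace R. (\<Sum>l\<in>UNIV. (queue R T \<omega> $ l)\<^sup>2) / 2 + V * ((\<Sum>t<T. \<Sum>n\<in>UNIV. pen R n t \<omega>) - real T * fs))
    = (\<Sum>l\<in>UNIV. LINT \<omega>|pspace R. (queue R T \<omega> $ l)\<^sup>2) / 2 + V * ((\<Sum>t<T. \<Sum>n\<in>UNIV. LINT \<omega>|pspace R. pen R n t \<omega>) - real T * fs)"
    by (simp add: queue_square_integrable pen_integrable P.prob_space)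
  also have "(\<Sum>t<T. \<Sum>n\<in>UNIV. LINT \<omega>|pspace R. pen R n t \<omega>) = real T * avg_pen R T"
    using T by (simp add: avg_pen_def)
  also have "(LINT \<omega>|pspace R. (\<Sum>n\<in>UNIV. G n \<omega>) + (\<Sum>t<T. \<Sum>l\<in>UNIV. queue R t \<omega> $ l * ?d $ l - queue R t \<omega> $ l * ext R t \<omega> $ l)
      + real CARD('l) * slope\<^sup>2 / 2 * real T)
    = (\<Sum>n\<in>UNIV. LINT \<omega>|pspace R. G n \<omega>) + real CARD('l) * slope\<^sup>2 / 2 * real T"
    by (simp add: Gi queue_ext_expectation queue_integrable P.prob_space)
  also have "(\<Sum>n\<in>UNIV. LINT \<omega>|pspace R. G n \<omega>)
      \<le> (\<Sum>n\<in>(UNIV :: 'n set). 2 * B * Y * V + 4 * real CARD('l) * slope * Z * B * real T)"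
    by (intro sum_mono Gle)
  finally show ?thesis by (simp add: right_diff_distrib)
qed

end

section \<open>Performance of the algorithm\<close>

context bounded_renewal
begin

text \<open>\<open>penalty_gap\<close> is the constant in front of \<open>V + T\<close> in the drift inequality, \<open>queue_growth\<close> the one in
  front of \<open>T\<close> in the bound for a quarter of the squared mean queues.\<close>

definition penalty_gap :: real where
  "penalty_gap = real CARD('n) * (2 * B * Y + 4 * real CARD('l) * slope * Z * B)
    + real CARD('l) * slope\<^sup>2 / 2"

definition queue_growth :: "real^'l \<Rightarrow> real" where
  "queue_growth \<gamma> = 2 * penalty_gap + real CARD('n) * (2 * cost_bound 1 \<gamma> * B) + (\<Sum>l\<in>UNIV. (\<gamma> $ l)\<^sup>2)"

lemma penalty_gap_nonneg: "0 \<le> penalty_gap"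
  unfolding penalty_gap_def using slope_nonneg B_ge_1 Y_nonneg Z_nonneg
  by (intro add_nonneg_nonneg mult_nonneg_nonneg divide_nonneg_nonneg) auto

lemma queue_growth_nonneg: "0 \<le> queue_growth \<gamma>"
  unfolding queue_growth_def using penalty_gap_nonneg cost_bound_nonneg[of 1 \<gamma>] B_ge_1
  by (intro add_nonneg_nonneg mult_nonneg_nonneg sum_nonneg) auto

end

context bounded_run
begin

lemma drift_plus_penalty_le:
  assumes alg: "follows_algorithm m V R" and V: "0 < V" and fs: "f_star m = ereal fs" and T: "0 < T"
  shows "(\<Sum>l\<in>UNIV. (LINT \<omega>|pspace R. queue R T \<omega> $ l)\<^sup>2) / 2 + V * (real T * (avg_pen R T - fs))
    \<le> penalty_gap * (V + real T)"
proof -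
  have "(LINT \<omega>|pspace R. queue R T \<omega> $ l)\<^sup>2 \<le> (LINT \<omega>|pspace R. (queue R T \<omega> $ l)\<^sup>2)" for l
    using P.variance_eq[OF queue_integrable queue_square_integrable, of T l]
      P.variance_positive[of "\<lambda>\<omega>. queue R T \<omega> $ l"] by simp
  then have "(\<Sum>l\<in>UNIV. (LINT \<omega>|pspace R. queue R T \<omega> $ l)\<^sup>2) \<le> (\<Sum>l\<in>UNIV. LINT \<omega>|pspace R. (queue R T \<omega> $ l)\<^sup>2)"
    by (intro sum_mono)
  moreover have "real CARD('n) * (2 * B * Y * V + 4 * real CARD('l) * slope * Z * B * real T)
      + real CARD('l) * slope\<^sup>2 / 2 * real T \<le> penalty_gap * (V + real T)"
  proof -
    have "0 \<le> real CARD('n) * (2 * B * Y * real T)"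
      "0 \<le> real CARD('n) * (4 * real CARD('l) * slope * Z * B * V)" "0 \<le> real CARD('l) * slope\<^sup>2 / 2 * V"
      using V Y_nonneg Z_nonneg B_ge_1 slope_nonneg by (auto intro!: mult_nonneg_nonneg)
    moreover have "penalty_gap * (V + real T) = real CARD('n) * (2 * B * Y * V + 4 * real CARD('l) * slope * Z * B * real T)
        + real CARD('l) * slope\<^sup>2 / 2 * real T + (real CARD('n) * (2 * B * Y * real T)
        + real CARD('n) * (4 * real CARD('l) * slope * Z * B * V) + real CARD('l) * slope\<^sup>2 / 2 * V)"
      by (simp add: penalty_gap_def field_simps)
    ultimately show ?thesis by linarith
  qed
  ultimately show ?thesis using drift_plus_penalty[OF alg V fs T] by linarith
qed

text \<open>The multiplier bounds the penalty from below in terms of the mean queues, so that the drift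
  inequality becomes quadratic in them.  The condition on \<open>T\<close> says \<open>V\<^sup>2 \<le> T\<close>, which turns all terms
  \<open>V\<close>, \<open>V\<^sup>2\<close> and \<open>T\<close> on the right into multiples of \<open>T\<close>.\<close>

lemma algorithm_performance:
  assumes \<epsilon>: "0 < \<epsilon>" "\<epsilon> < 1" and alg: "follows_algorithm m (1 / \<epsilon>) R" and fs: "f_star m = ereal fs"
    and \<gamma>: "\<And>l. 0 \<le> \<gamma> $ l"
    and multiplier: "fs + \<gamma> \<bullet> ext_mean m \<le> (\<Sum>n\<in>UNIV. min_cost n 1 \<gamma>)"
    and T: "1 / \<epsilon>\<^sup>2 \<le> real T"
  shows "avg_pen R T \<le> fs + 2 * penalty_gap * \<epsilon>"
    and "avg_met R l T \<le> ext_mean m $ l + 2 * sqrt (queue_growth \<gamma>) * \<epsilon>"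
proof -
  define V where "V = 1 / \<epsilon>"
  define q where "q l = (LINT \<omega>|pspace R. queue R T \<omega> $ l)" for l
  let ?d = "ext_mean m" and ?t = "real T"
  have V: "1 < V" using \<epsilon> by (simp add: V_def)
  have VT: "V\<^sup>2 \<le> ?t" using T by (simp add: V_def power_one_over)
  have "V \<le> V\<^sup>2" using V by (simp add: power2_eq_square)
  with VT have VT': "V \<le> ?t" by simp
  then have T0: "0 < T" using V by (cases T) auto
  have drift: "(\<Sum>l\<in>UNIV. (q l)\<^sup>2) / 2 + V * (?t * (avg_pen R T - fs)) \<le> penalty_gap * (V + ?t)"
    unfolding q_def using V by (intro drift_plus_penalty_le[OF alg[folded V_def] _ fs T0]) simp
  have "V * (?t * (avg_pen R T - fs)) \<le> penalty_gap * (2 * ?t)"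
  proof -
    have "0 \<le> (\<Sum>l\<in>UNIV. (q l)\<^sup>2) / 2" by (simp add: sum_nonneg)
    moreover have "penalty_gap * (V + ?t) \<le> penalty_gap * (2 * ?t)"
      using VT' penalty_gap_nonneg by (intro mult_left_mono) auto
    ultimately show ?thesis using drift by linarith
  qed
  then have "?t * (V * (avg_pen R T - fs)) \<le> ?t * (2 * penalty_gap)" by (simp add: mult_ac)
  then have "V * (avg_pen R T - fs) \<le> 2 * penalty_gap" using T0 by simp
  then show "avg_pen R T \<le> fs + 2 * penalty_gap * \<epsilon>"
    using \<epsilon> by (simp add: V_def field_simps)
  have q0: "0 \<le> q l" for l unfolding q_def by (intro integral_nonneg_AE AE_I2 queue_nonneg)
  have q_ge: "?t * (avg_met R l T - ?d $ l) \<le> q l" for l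
    unfolding q_def by (rule queue_expectation_ge[OF T0])
  let ?K = "real CARD('n) * (2 * cost_bound 1 \<gamma> * B)"
  have "fs + \<gamma> \<bullet> ?d - ?K / ?t \<le> avg_pen R T + (\<Sum>l\<in>UNIV. \<gamma> $ l * avg_met R l T)"
    using avg_lower[OF T0, of 1 \<gamma>] multiplier by simp
  then have "?t * (fs + \<gamma> \<bullet> ?d - ?K / ?t) \<le> ?t * (avg_pen R T + (\<Sum>l\<in>UNIV. \<gamma> $ l * avg_met R l T))"
    by (intro mult_left_mono) auto
  then have "- ?K - (\<Sum>l\<in>UNIV. \<gamma> $ l * (?t * (avg_met R l T - ?d $ l))) \<le> ?t * (avg_pen R T - fs)"
    using T0 by (simp add: inner_vec_def algebra_simps sum_subtractf sum_distrib_left sum.distrib)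
  moreover have "(\<Sum>l\<in>UNIV. \<gamma> $ l * (?t * (avg_met R l T - ?d $ l))) \<le> (\<Sum>l\<in>UNIV. \<gamma> $ l * q l)"
    by (intro sum_mono mult_left_mono q_ge \<gamma>)
  ultimately have "- ?K - (\<Sum>l\<in>UNIV. \<gamma> $ l * q l) \<le> ?t * (avg_pen R T - fs)" by linarith
  then have "V * (- ?K - (\<Sum>l\<in>UNIV. \<gamma> $ l * q l)) \<le> V * (?t * (avg_pen R T - fs))"
    using V by (intro mult_left_mono) auto
  moreover have "V * (- ?K - (\<Sum>l\<in>UNIV. \<gamma> $ l * q l)) = - (V * ?K) - (\<Sum>l\<in>UNIV. V * \<gamma> $ l * q l)"
    by (simp add: right_diff_distrib sum_distrib_left mult.assoc)
  ultimately have half: "(\<Sum>l\<in>UNIV. (q l)\<^sup>2) / 2 \<le> penalty_gap * (V + ?t) + V * ?K + (\<Sum>l\<in>UNIV. V * \<gamma> $ l * q l)"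
    using drift by linarith
  \<comment> \<open>Half of the squares on the left absorbs the linear terms.\<close>
  have "(\<Sum>l\<in>UNIV. V * \<gamma> $ l * q l) \<le> (\<Sum>l\<in>UNIV. (q l)\<^sup>2 / 4 + V\<^sup>2 * (\<gamma> $ l)\<^sup>2)"
  proof (rule sum_mono)
    fix l
    have "0 \<le> (q l / 2 - V * \<gamma> $ l)\<^sup>2" by simp
    then show "V * \<gamma> $ l * q l \<le> (q l)\<^sup>2 / 4 + V\<^sup>2 * (\<gamma> $ l)\<^sup>2"
      by (simp add: power2_eq_square algebra_simps)
  qed
  also have "\<dots> = (\<Sum>l\<in>UNIV. (q l)\<^sup>2) / 4 + V\<^sup>2 * (\<Sum>l\<in>UNIV. (\<gamma> $ l)\<^sup>2)"
    by (simp add: sum.distrib sum_distrib_left sum_divide_distrib)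
  finally have "(\<Sum>l\<in>UNIV. (q l)\<^sup>2) / 4 \<le> penalty_gap * (V + ?t) + V * ?K + V\<^sup>2 * (\<Sum>l\<in>UNIV. (\<gamma> $ l)\<^sup>2)"
    using half by linarith
  also have "\<dots> \<le> penalty_gap * (2 * ?t) + ?t * ?K + ?t * (\<Sum>l\<in>UNIV. (\<gamma> $ l)\<^sup>2)"
    using VT VT' penalty_gap_nonneg cost_bound_nonneg[of 1 \<gamma>] B_ge_1
    by (intro add_mono mult_left_mono mult_right_mono) (auto simp: sum_nonneg)
  also have "\<dots> = queue_growth \<gamma> * ?t" by (simp add: queue_growth_def algebra_simps)
  finally have "(\<Sum>l\<in>UNIV. (q l)\<^sup>2) / 4 \<le> queue_growth \<gamma> * ?t" .
  moreover have "(q l)\<^sup>2 \<le> (\<Sum>l\<in>UNIV. (q l)\<^sup>2)" by (rule member_le_sum) auto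
  ultimately have "(q l)\<^sup>2 \<le> 4 * queue_growth \<gamma> * ?t" by linarith
  also have "\<dots> \<le> (2 * sqrt (queue_growth \<gamma>) * \<epsilon> * ?t)\<^sup>2"
  proof -
    have "?t \<le> \<epsilon>\<^sup>2 * ?t\<^sup>2"
      using mult_right_mono[OF T, of "\<epsilon>\<^sup>2 * ?t"] \<epsilon> by (simp add: power2_eq_square field_simps)
    then have "4 * queue_growth \<gamma> * ?t \<le> 4 * queue_growth \<gamma> * (\<epsilon>\<^sup>2 * ?t\<^sup>2)"
      using queue_growth_nonneg[of \<gamma>] by (intro mult_left_mono) auto
    then show ?thesis using queue_growth_nonneg[of \<gamma>] by (simp add: power_mult_distrib)
  qed
  finally have "q l \<le> 2 * sqrt (queue_growth \<gamma>) * \<epsilon> * ?t"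
    by (rule power2_le_imp_le) (use \<epsilon> queue_growth_nonneg[of \<gamma>] in auto)
  with q_ge[of l] have "?t * (avg_met R l T - ?d $ l) \<le> ?t * (2 * sqrt (queue_growth \<gamma>) * \<epsilon>)"
    by (simp add: mult_ac)
  then show "avg_met R l T \<le> ?d $ l + 2 * sqrt (queue_growth \<gamma>) * \<epsilon>"
    using T0 by simp
qed

end

lemma bounded_renewal_exists:
  fixes m :: "('n::finite, 'l::finite, 'a) model"
  assumes "renewal_model m" "bounded_model m"
  obtains Y Z D B where "bounded_renewal m Y Z D B"
proof -
  obtain y z d B where
    yz: "\<forall>n k. \<forall>a\<in>space (actions m n). AE (T, y', z') in frame_law m n k a.
        \<forall>i<T. \<bar>y' i\<bar> \<le> y \<and> (\<forall>l. \<bar>z' i $ l\<bar> \<le> z)"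
    and d: "AE x in ext_law m. \<forall>l. \<bar>x $ l\<bar> \<le> d" and B: "1 \<le> B"
    and res: "\<forall>n k. \<forall>a\<in>space (actions m n). \<forall>s::nat.
        let K = frame_law m n k a; S = {w \<in> space K. fst w \<ge> s} in
        measure K S > 0 \<longrightarrow>
        (\<integral>\<^sup>+ w. ennreal ((real (fst w) - real s)\<^sup>2) \<partial>uniform_measure K S) \<le> ennreal B"
    using assms(2) unfolding bounded_model_def by blast
  have sp: "space (frame_law m n k a) = UNIV" if "a \<in> space (actions m n)" for n k a
  proof -
    have "frame_law m n k \<in> actions m n \<rightarrow>\<^sub>M prob_algebra frame_space"
      using assms(1) unfolding renewal_model_def by blast
    from measurable_space[OF this that] have "sets (frame_law m n k a) = sets frame_space"
      by (simp add: space_prob_algebra)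
    from sets_eq_imp_space_eq[OF this] show ?thesis by simp
  qed
  have "bounded_renewal m (max y 0) (max z 0) (max d 0) B"
  proof
    fix n k a assume a: "a \<in> space (actions m n)"
    show "AE w in frame_law m n k a. \<forall>i<fst w. \<bar>fst (snd w) i\<bar> \<le> max y 0 \<and> (\<forall>l. \<bar>snd (snd w) i $ l\<bar> \<le> max z 0)"
      using yz[rule_format, OF a, of k] by eventually_elim (auto simp: le_max_iff_disj)
    fix s :: nat
    assume "measure (frame_law m n k a) {w. s \<le> fst w} > 0"
    then show "(\<integral>\<^sup>+ w. ennreal ((real (fst w) - real s)\<^sup>2)
        \<partial>uniform_measure (frame_law m n k a) {w. s \<le> fst w}) \<le> ennreal B"
      using res[rule_format, OF a, of k s] by (simp add: Let_def sp[OF a])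
  next
    show "AE x in ext_law m. \<forall>l. \<bar>x $ l\<bar> \<le> max d 0"
      using d by eventually_elim (auto simp: le_max_iff_disj)
  qed (use assms(1) B in auto)
  then show ?thesis by (rule that)
qed

theorem theorem4p1:
  fixes m :: "('n::finite, 'l::finite, 'a) model"
    and \<gamma> :: "'l \<Rightarrow> real"
  assumes "renewal_model m"
    and "bounded_model m"
    and "compact_model m"
    and "feasible m"
    and "\<And>l. \<gamma> l \<ge> 0"
    and "\<And>fbar gbar. (\<And>n. (fbar n, gbar n) \<in> perf_P m n) \<Longrightarrow>
           ereal ((\<Sum>n\<in>UNIV. fbar n) + (\<Sum>l\<in>UNIV. \<gamma> l * (\<Sum>n\<in>UNIV. gbar n $ l)))
             \<ge> f_star m + ereal (\<Sum>l\<in>UNIV. \<gamma> l * ext_mean m $ l)"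
  shows "\<exists>C::real. \<forall>\<epsilon>::real. 0 < \<epsilon> \<and> \<epsilon> < 1 \<longrightarrow>
           (\<forall>R :: ('w, 'n, 'l, 'a) run.
              renewal_run m R \<and> follows_algorithm m (1 / \<epsilon>) R \<longrightarrow>
              (\<forall>T::nat. real T \<ge> 1 / \<epsilon>\<^sup>2 \<longrightarrow>
                 ereal (avg_pen R T) \<le> f_star m + ereal (C * \<epsilon>) \<and>
                 (\<forall>l. avg_met R l T \<le> ext_mean m $ l + C * \<epsilon>)))"
proof -
  obtain Y Z D B where "bounded_renewal m Y Z D B"
    using bounded_renewal_exists[OF assms(1,2)] .
  then interpret bounded_renewal m Y Z D B .
  define g :: "real^'l" where "g = (\<chi> l. \<gamma> l)"
  have g: "0 \<le> g $ l" for l using assms(5) by (simp add: g_def)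
  have ne: "space (actions m n) \<noteq> {}" for n
  proof -
    obtain R :: "(('n, 'l, 'a) trajectory, 'n, 'l, 'a) run" where "admissible m R"
      using assms(4) unfolding feasible_def by blast
    then interpret bounded_run m Y Z D B R
      by unfold_locales (simp add: admissible_def)
    show ?thesis by (rule actions_nonempty)
  qed
  have cost_of_choice: "f_star m + ereal (g \<bullet> ext_mean m) \<le> ereal (\<Sum>n\<in>UNIV. cost n 1 g (a n))"
    if "\<And>n. a n \<in> space (actions m n)" for a
  proof -
    have "(\<Sum>n\<in>UNIV. fhat m n (a n)) + (\<Sum>l\<in>UNIV. \<gamma> l * (\<Sum>n\<in>UNIV. ghat m n (a n) $ l))
        = (\<Sum>n\<in>UNIV. cost n 1 g (a n))"
      unfolding cost_def inner_vec_def sum.distrib sum_distrib_left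
      by (subst sum.swap[of _ UNIV]) (simp add: g_def)
    moreover have "(\<Sum>l\<in>UNIV. \<gamma> l * ext_mean m $ l) = g \<bullet> ext_mean m"
      by (simp add: g_def inner_vec_def)
    ultimately show ?thesis
      using assms(6)[of "\<lambda>n. fhat m n (a n)" "\<lambda>n. ghat m n (a n)"] in_perf_P[OF that] by simp
  qed
  have "\<forall>n. \<exists>a. a \<in> space (actions m n)" using ne by blast
  then obtain a0 where "\<And>n. a0 n \<in> space (actions m n)" by metis
  from cost_of_choice[OF this] have "f_star m \<noteq> \<infinity>" by auto
  moreover have "f_star m \<noteq> - \<infinity>" using weak_duality[of 1 0] by auto
  ultimately obtain fs where fs: "f_star m = ereal fs" by (cases "f_star m") auto
  \<comment> \<open>The hypothesis, applied to nearly optimal actions chosen separately for each system.\<close>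
  have multiplier: "fs + g \<bullet> ext_mean m \<le> (\<Sum>n\<in>UNIV. min_cost n 1 g)"
  proof (rule field_le_epsilon)
    fix e :: real assume e: "0 < e"
    define \<delta> where "\<delta> = e / real CARD('n)"
    have \<delta>: "0 < \<delta>" using e by (simp add: \<delta>_def)
    have "\<exists>a\<in>space (actions m n). cost n 1 g a \<le> min_cost n 1 g + \<delta>" for n
    proof (rule ccontr)
      assume "\<not> ?thesis"
      then have "min_cost n 1 g + \<delta> \<le> min_cost n 1 g"
        by (intro min_cost_greatest[OF ne]) (auto intro: less_imp_le)
      with \<delta> show False by simp
    qed
    then obtain a where a: "\<And>n. a n \<in> space (actions m n)" "\<And>n. cost n 1 g (a n) \<le> min_cost n 1 g + \<delta>"
      by metis
    have "fs + g \<bullet> ext_mean m \<le> (\<Sum>n\<in>UNIV. cost n 1 g (a n))"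
      using cost_of_choice[OF a(1)] fs by simp
    also have "\<dots> \<le> (\<Sum>n\<in>UNIV. min_cost n 1 g + \<delta>)" by (intro sum_mono a(2))
    also have "\<dots> = (\<Sum>n\<in>UNIV. min_cost n 1 g) + e" by (simp add: sum.distrib \<delta>_def)
    finally show "fs + g \<bullet> ext_mean m \<le> (\<Sum>n\<in>UNIV. min_cost n 1 g) + e" .
  qed
  show ?thesis
  proof (rule exI[of _ "max (2 * penalty_gap) (2 * sqrt (queue_growth g))"], intro allI impI)
    fix \<epsilon> :: real and R :: "('w, 'n, 'l, 'a) run" and T :: nat
    assume \<epsilon>: "0 < \<epsilon> \<and> \<epsilon> < 1" and R: "renewal_run m R \<and> follows_algorithm m (1 / \<epsilon>) R"
      and T: "1 / \<epsilon>\<^sup>2 \<le> real T"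
    interpret bounded_run m Y Z D B R by unfold_locales (use R in blast)
    let ?C = "max (2 * penalty_gap) (2 * sqrt (queue_growth g))"
    have C: "2 * penalty_gap * \<epsilon> \<le> ?C * \<epsilon>" "2 * sqrt (queue_growth g) * \<epsilon> \<le> ?C * \<epsilon>"
      using \<epsilon> by (auto intro!: mult_right_mono)
    note perf = algorithm_performance[OF conjunct1[OF \<epsilon>] conjunct2[OF \<epsilon>] conjunct2[OF R] fs g multiplier T]
    have "avg_pen R T \<le> fs + ?C * \<epsilon>" using perf(1) C(1) by linarith
    moreover have "avg_met R l T \<le> ext_mean m $ l + ?C * \<epsilon>" for l using perf(2)[of l] C(2) by linarith
    ultimately show "ereal (avg_pen R T) \<le> f_star m + ereal (?C * \<epsilon>) \<and>
        (\<forall>l. avg_met R l T \<le> ext_mean m $ l + ?C * \<epsilon>)"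
      by (simp add: fs)
  qed
qed

end
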